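(* Let $\xi:[0,1]\to\mathbb{R}$ be a smooth strictly monotone function with $\int_0^1\xi(y)\,dy=0$, and let $C>0$. Then for all sufficiently small $r_0>0$ the following holds for every $\hat G\in\hat{\mathcal S}_{r_0}$ and all $x,p\in(0,1)$ with $x<p$. With $$T(y)=\min\{n>0 \; ; \; \hat g^n_y(x)>p\}$$ ($T(y)=\infty$ if no such $n$ exists): (1) $T(y)<\infty$ for Lebesgue almost all $y\in[0,1]$; (2) $\int_0^1 T(y)\,dy=\infty$.
   Context: $E_2:[0,1]\to[0,1]$ is the doubling map $E_2(y)=2y-\lfloor 2y\rfloor$. For fixed $\xi$ and $C>0$, and for $r_0>0$, $\hat{\mathcal S}_{r_0}$ is the set of skew product maps $\hat G:[0,1]\times[0,1]\to[0,1]\times[0,1]$, $\hat G(y,x)=(E_2(y),\hat g_y(x))$, where $(y,x)\mapsto\hat g_y(x)$ is smooth, each $\hat g_y:[0,1]\to[0,1]$ is strictly increasing, and $$\hat g_y(x)=\frac{e^{\xi(y)}x}{1+(e^{\xi(y)}-1)x}+r(y,x)$$ with $|r(y,x)|\le Cx^2$, $|r(y,x)|\le C|1-x|$, and $|r(y,x)|,|\partial_x r(y,x)|,|\partial_y r(y,x)|\le r_0$ for all $(y,x)$. (In particular $\hat g_y(0)=0$, $\hat g_y(1)=1$.) Iterates: $\hat g^n_y=\hat g_{E_2^{n-1}(y)}\circ\cdots\circ\hat g_{E_2(y)}\circ\hat g_y$, so that $\hat G^n(y,x)=(E_2^n(y),\hat g_y^n(x))$. *)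

theory Defs
  imports "HOL-Analysis.Analysis"
begin

text \<open>\<open>higher_differentiable_on U f k\<close> is intended for open \<open>U\<close>, where it says that \<open>f\<close> is of
  class \<open>C\<^sup>k\<close>: all iterated directional derivatives up to order \<open>k\<close> exist and are continuous.\<close>

primrec higher_differentiable_on ::
  "'a::euclidean_space set \<Rightarrow> ('a \<Rightarrow> 'b::real_normed_vector) \<Rightarrow> nat \<Rightarrow> bool" where
  "higher_differentiable_on U f 0 \<longleftrightarrow> continuous_on U f"
| "higher_differentiable_on U f (Suc k) \<longleftrightarrow>
     (\<forall>x\<in>U. f differentiable (at x)) \<and>
     (\<forall>v. higher_differentiable_on U (\<lambda>x. frechet_derivative f (at x) v) k)"

text \<open>Smoothness on a set that need not be open (here a compact interval or the closed unit
  square) means, as usual, being the restriction of a \<open>C\<^sup>\<infinity>\<close> function on an open neighbourhood.\<close>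

definition smooth_on :: "'a::euclidean_space set \<Rightarrow> ('a \<Rightarrow> 'b::real_normed_vector) \<Rightarrow> bool" where
  "smooth_on S f \<longleftrightarrow>
     (\<exists>U F. open U \<and> S \<subseteq> U \<and> (\<forall>x\<in>S. F x = f x) \<and> (\<forall>k. higher_differentiable_on U F k))"

definition doubling :: "real \<Rightarrow> real" where
  "doubling y = 2 * y - of_int \<lfloor>2 * y\<rfloor>"

text \<open>The fibre map \<open>g\<^sub>y\<close> of a skew product \<open>G (y, x) = (doubling y, g\<^sub>y x)\<close>; the base
  coordinate comes first.\<close>

definition fibre_map :: "(real \<times> real \<Rightarrow> real \<times> real) \<Rightarrow> real \<Rightarrow> real \<Rightarrow> real" where
  "fibre_map G y x = snd (G (y, x))"

text \<open>\<open>fibre_iter G n y\<close> is \<open>fibre_map G (doubling\<^sup>n\<^sup>-\<^sup>1 y) \<circ> \<dots> \<circ> fibre_map G (doubling y) \<circ> fibre_map G y\<close>.\<close>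

primrec fibre_iter :: "(real \<times> real \<Rightarrow> real \<times> real) \<Rightarrow> nat \<Rightarrow> real \<Rightarrow> real \<Rightarrow> real" where
  "fibre_iter G 0 y = id"
| "fibre_iter G (Suc n) y = fibre_map G ((doubling ^^ n) y) \<circ> fibre_iter G n y"

definition remainder :: "(real \<Rightarrow> real) \<Rightarrow> (real \<times> real \<Rightarrow> real \<times> real) \<Rightarrow> real \<Rightarrow> real \<Rightarrow> real" where
  "remainder \<xi> G y x =
     fibre_map G y x - exp (\<xi> y) * x / (1 + (exp (\<xi> y) - 1) * x)"

text \<open>Maps of the unit square are represented by total functions on the plane, whose values
  outside the square are left unconstrained. Derivatives are therefore taken within the unit
  interval, hence one-sided at its end points.\<close>

definition skew_maps ::
  "(real \<Rightarrow> real) \<Rightarrow> real \<Rightarrow> real \<Rightarrow> (real \<times> real \<Rightarrow> real \<times> real) set" where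
  "skew_maps \<xi> C r\<^sub>0 = {G.
     smooth_on ({0..1} \<times> {0..1}) (\<lambda>(y, x). fibre_map G y x) \<and>
     (\<forall>y\<in>{0..1}. fibre_map G y ` {0..1} \<subseteq> {0..1} \<and> strict_mono_on {0..1} (fibre_map G y)) \<and>
     (\<forall>y\<in>{0..1}. \<forall>x\<in>{0..1}.
        G (y, x) = (doubling y, fibre_map G y x) \<and>
        \<bar>remainder \<xi> G y x\<bar> \<le> C * x\<^sup>2 \<and>
        \<bar>remainder \<xi> G y x\<bar> \<le> C * \<bar>1 - x\<bar> \<and>
        \<bar>remainder \<xi> G y x\<bar> \<le> r\<^sub>0 \<and>
        \<bar>vector_derivative (\<lambda>t. remainder \<xi> G y t) (at x within {0..1})\<bar> \<le> r\<^sub>0 \<and>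
        \<bar>vector_derivative (\<lambda>t. remainder \<xi> G t x) (at y within {0..1})\<bar> \<le> r\<^sub>0)}"

definition passage_time ::
  "(real \<times> real \<Rightarrow> real \<times> real) \<Rightarrow> real \<Rightarrow> real \<Rightarrow> real \<Rightarrow> enat" where
  "passage_time G x p y =
     (if \<exists>n>0. fibre_iter G n y x > p
      then enat (LEAST n. n > 0 \<and> fibre_iter G n y x > p) else \<infinity>)"

end

theory Submission
  imports Defs
begin

text \<open>In the coordinate \<open>w = logit x = ln (x / (1 - x))\<close> the fibre maps become
  \<open>w \<mapsto> w + \<xi> y + O(min r\<^sub>0 (C exp w))\<close>: a mean-zero walk with a small drift that is exponentially
  weak near the neutral fixed point \<open>x = 0\<close>. Replacing the Birkhoff sums of \<open>\<xi>\<close> by their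
  conditional expectations given the binary digits read so far costs a bounded error, and yields a
  martingale with increments \<open>\<plusminus> t\<close>, where \<open>\<bar>t\<bar>\<close> is bounded and bounded away from zero by
  monotonicity of \<open>\<xi>\<close>. Adding the worst possible drift gives processes on binary words that bound
  the orbit from below and from above. A supermartingale tending to infinity at \<open>w = -\<infinity>\<close> shows that
  the lower process almost surely exceeds any level. A linearly growing submartingale shows that the
  upper process, once low enough, has survival probability at least of order \<open>1 / n\<close>, so that the
  passage time has infinite expectation; the orbit reaches such low values along the digits of the
  fixed point of the doubling map where \<open>\<xi>\<close> is negative.\<close>

section \<open>Killed walks on binary words\<close>

definition words :: "nat \<Rightarrow> bool list set" where
  "words n = {u. length u = n}"

lemma words_0 [simp]: "words 0 = {[]}"
  by (auto simp: words_def)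

lemma length_words: "u \<in> words n \<Longrightarrow> length u = n"
  by (simp add: words_def)

lemma words_Suc: "words (Suc n) = (#) True ` words n \<union> (#) False ` words n"
proof -
  have "words (Suc n) = (\<Union>b. (#) b ` words n)"
    by (auto simp: words_def length_Suc_conv image_iff)
  then show ?thesis by (simp add: UNIV_bool Un_commute)
qed

lemma finite_words [simp]: "finite (words n)"
  by (induction n) (simp_all add: words_Suc)

lemma sum_words_Suc:
  "(\<Sum>u\<in>words (Suc n). f u) = (\<Sum>u\<in>words n. f (True # u) + f (False # u))"
  for f :: "bool list \<Rightarrow> real"
proof -
  have "(\<Sum>u\<in>words (Suc n). f u) = sum f ((#) True ` words n) + sum f ((#) False ` words n)"
    unfolding words_Suc by (rule sum.union_disjoint) auto
  also have "\<dots> = (\<Sum>u\<in>words n. f (True # u)) + (\<Sum>u\<in>words n. f (False # u))"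
    by (simp add: sum.reindex inj_on_def)
  finally show ?thesis by (simp add: sum.distrib)
qed

text \<open>The head of a word is the latest step, so its tails are the earlier stages of the walk:
  the condition covers the whole history, start included.\<close>

primrec stays_below :: "(bool list \<Rightarrow> real) \<Rightarrow> real \<Rightarrow> bool list \<Rightarrow> bool" where
  "stays_below v H [] \<longleftrightarrow> v [] \<le> H"
| "stays_below v H (b # u) \<longleftrightarrow> v (b # u) \<le> H \<and> stays_below v H u"

lemma stays_below_le: "stays_below v H u \<Longrightarrow> v u \<le> H"
  by (cases u) auto

text \<open>Probability, under fair coin tosses, that the walk at \<open>v u\<close> after the
  tosses \<open>u\<close> has not been killed by time \<open>n\<close>.\<close>

definition survival :: "(bool list \<Rightarrow> real) \<Rightarrow> real \<Rightarrow> nat \<Rightarrow> real" where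
  "survival v H n = (\<Sum>u\<in>words n. of_bool (stays_below v H u)) / 2 ^ n"

lemma survival_nonneg: "0 \<le> survival v H n"
  by (simp add: survival_def sum_nonneg)

section \<open>One-step estimates and survival of killed walks\<close>

lemma cosh_ge_of_abs_ge:
  fixes t :: real assumes "0 \<le> \<delta>" "\<delta> \<le> \<bar>t\<bar>" shows "cosh \<delta> \<le> cosh t"
proof -
  have "cosh \<delta> \<le> cosh \<bar>t\<bar>" using assms by (subst cosh_real_nonneg_le_iff) auto
  then show ?thesis by (simp add: abs_if split: if_splits)
qed

text \<open>The logarithms combine into that of \<open>(s + c)\<^sup>2 - t\<^sup>2\<close>, and
  \<open>ln z \<le> z - 1\<close> linearises its ratio to \<open>s\<^sup>2\<close>. The last term is
  the gain from strict concavity; \<open>D + 1 \<le> s\<close> keeps both arguments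
  positive.\<close>

lemma log_drift:
  fixes s c t :: real
  assumes "\<bar>t\<bar> \<le> D" "\<delta> \<le> \<bar>t\<bar>" "0 \<le> \<delta>" "D + 1 \<le> s" "0 \<le> c" "c \<le> 1"
  shows "(ln (s + c - t) + ln (s + c + t)) / 2 \<le> ln s + 3 / 2 * c - \<delta>\<^sup>2 / (2 * s\<^sup>2)"
proof -
  have s1: "1 \<le> s" using assms by linarith
  have p: "s + c - t > 0" "s + c + t > 0" using assms by linarith+
  have "ln (s + c - t) + ln (s + c + t) - 2 * ln s = ln ((s + c - t) * (s + c + t) / s\<^sup>2)"
    using p s1 by (simp add: ln_div ln_mult ln_realpow)
  also have "\<dots> \<le> (s + c - t) * (s + c + t) / s\<^sup>2 - 1"
    using p s1 by (intro ln_le_minus_one) auto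
  also have "\<dots> = (2 * s * c + c\<^sup>2 - t\<^sup>2) / s\<^sup>2"
    using s1 by (simp add: field_simps power2_eq_square)
  also have "\<dots> \<le> (3 * s\<^sup>2 * c - \<delta>\<^sup>2) / s\<^sup>2"
  proof -
    have "c\<^sup>2 \<le> s\<^sup>2 * c" "s * c \<le> s\<^sup>2 * c"
    proof -
      have "c * c \<le> 1 * c" using assms by (intro mult_right_mono)
      moreover have "s * 1 \<le> s * s" using s1 by (intro mult_left_mono) auto
      then have "s * c \<le> s * s * c" using assms by (intro mult_right_mono) auto
      moreover have "1 * c \<le> s * c" using assms s1 by (intro mult_right_mono) auto
      ultimately show "c\<^sup>2 \<le> s\<^sup>2 * c" "s * c \<le> s\<^sup>2 * c" by (simp_all add: power2_eq_square)
    qed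
    moreover have "\<delta>\<^sup>2 \<le> t\<^sup>2" using assms by (metis abs_le_square_iff abs_of_nonneg)
    ultimately show ?thesis by (intro divide_right_mono) auto
  qed
  also have "\<dots> = 3 * c - \<delta>\<^sup>2 / s\<^sup>2" using s1 by (simp add: field_simps)
  finally show ?thesis by simp
qed

text \<open>Below, \<open>\<Psi>\<close> is a positive supermartingale: convexity of \<open>exp\<close> pays for the drift, and the
  logarithm makes \<open>\<Psi>\<close> unbounded at \<open>-\<infinity>\<close>.\<close>

lemma survival_tendsto_0:
  fixes v c t :: "bool list \<Rightarrow> real"
  assumes vT: "\<And>u. v (True # u) = v u - c u + t u"
    and vF: "\<And>u. v (False # u) = v u - c u - t u"
    and t: "\<And>u. \<delta> \<le> \<bar>t u\<bar>" "\<And>u. \<bar>t u\<bar> \<le> D"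
    and c: "\<And>u. 0 \<le> c u" "\<And>u. c u \<le> q" "\<And>u. c u \<le> A * exp (v u)"
    and \<delta>: "0 < \<delta>" and q: "q \<le> 1" "exp q < cosh \<delta>" and A: "0 < A"
  shows "survival v H \<longlonglongrightarrow> 0"
proof -
  have D0: "0 < D" using t[of "[]"] \<delta> by linarith
  \<comment> \<open>One step from a position at most \<open>H\<close> ends at most at
    \<open>H + D\<close>; there \<open>h - w \<ge> 1\<close>, so the logarithm in
    \<open>\<Psi>\<close> is nonnegative even after an overshoot.\<close>
  define h where "h = H + D + 1"
  define \<kappa> where "\<kappa> = exp (- q) * cosh \<delta> - 1"
  have \<kappa>: "\<kappa> > 0" using q unfolding \<kappa>_def by (simp add: exp_minus field_simps)
  \<comment> \<open>Solves \<open>\<eta> * (3 / 2 * A) = \<kappa>\<close>: the mean growth factor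
    \<open>1 + \<kappa>\<close> of \<open>exp\<close> cancels the cost of the drift in the
    logarithm.\<close>
  define \<eta> where "\<eta> = 2 * \<kappa> / (3 * A)"
  have \<eta>: "\<eta> > 0" using \<kappa> A by (simp add: \<eta>_def)
  define \<Psi> where "\<Psi> = (\<lambda>w. exp h - exp w + \<eta> * ln (h - w))"
  define loss where "loss = (\<lambda>w. \<eta> * \<delta>\<^sup>2 / (2 * (h - w)\<^sup>2))"
  have \<Psi>_nonneg: "0 \<le> \<Psi> w" if "w \<le> H + D" for w
    unfolding \<Psi>_def using that \<eta> by (intro add_nonneg_nonneg mult_nonneg_nonneg) (auto simp: h_def)
  have step: "(\<Psi> (v (True # u)) + \<Psi> (v (False # u))) / 2 \<le> \<Psi> (v u) - loss (v u)"
    if "v u \<le> H" for u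
  proof -
    define s where "s = h - v u"
    have "exp (v u) * (1 + \<kappa>) = exp (v u) * (exp (- q) * cosh \<delta>)" by (simp add: \<kappa>_def)
    also have "\<dots> \<le> exp (v u) * (exp (- c u) * cosh (t u))"
      using c(2)[of u] t \<delta> by (intro mult_left_mono mult_mono cosh_ge_of_abs_ge) auto
    also have "\<dots> = (exp (v (True # u)) + exp (v (False # u))) / 2"
      by (simp add: vT vF cosh_def exp_add exp_diff exp_minus field_simps)
    finally have E: "exp (v u) * (1 + \<kappa>) \<le> (exp (v (True # u)) + exp (v (False # u))) / 2" .
    have "(ln (h - v (True # u)) + ln (h - v (False # u))) / 2 = (ln (s + c u - t u) + ln (s + c u + t u)) / 2"
      by (simp add: vT vF s_def algebra_simps)
    also have "\<dots> \<le> ln s + 3 / 2 * c u - \<delta>\<^sup>2 / (2 * s\<^sup>2)"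
      using t c(1,2)[of u] \<delta> q that by (intro log_drift[where D = D]) (auto simp: s_def h_def)
    also have "\<dots> \<le> ln s + 3 / 2 * (A * exp (v u)) - \<delta>\<^sup>2 / (2 * s\<^sup>2)"
      using c(3)[of u] by linarith
    finally have "\<eta> * ((ln (h - v (True # u)) + ln (h - v (False # u))) / 2) \<le>
        \<eta> * (ln s + 3 / 2 * (A * exp (v u)) - \<delta>\<^sup>2 / (2 * s\<^sup>2))"
      using \<eta> by (intro mult_left_mono) auto
    also have "\<dots> = \<eta> * ln s + \<kappa> * exp (v u) - loss (v u)"
      using A by (simp add: \<eta>_def loss_def s_def[symmetric] field_simps)
    finally have "\<eta> * ((ln (h - v (True # u)) + ln (h - v (False # u))) / 2) \<le>
        \<eta> * ln s + \<kappa> * exp (v u) - loss (v u)" .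
    moreover have "exp (v u) + \<kappa> * exp (v u) \<le> (exp (v (True # u)) + exp (v (False # u))) / 2"
      using E by (simp add: algebra_simps)
    ultimately show ?thesis
      unfolding \<Psi>_def s_def by (simp only: add_divide_distrib diff_divide_distrib distrib_left)
  qed
  \<comment> \<open>\<open>a n\<close> and \<open>l n\<close> are the expectations, over the words
    still alive, of \<open>\<Psi>\<close> and of its guaranteed one-step decrease.\<close>
  define a where "a n = (\<Sum>u\<in>words n. of_bool (stays_below v H u) * \<Psi> (v u)) / 2 ^ n" for n
  define l where "l n = (\<Sum>u\<in>words n. of_bool (stays_below v H u) * loss (v u)) / 2 ^ n" for n
  have a_nonneg: "0 \<le> a n" for n
  proof -
    have "0 \<le> \<Psi> (v u)" if "stays_below v H u" for u
      using stays_below_le[OF that] D0 by (intro \<Psi>_nonneg) simp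
    then show ?thesis
      unfolding a_def by (intro divide_nonneg_nonneg sum_nonneg) (auto simp: of_bool_def)
  qed
  have l_nonneg: "0 \<le> l n" for n
    unfolding l_def loss_def using \<eta> by (intro divide_nonneg_nonneg sum_nonneg) auto
  \<comment> \<open>Dropping killed words only lowers the sum, as \<open>\<Psi>\<close> is still
    nonnegative where they are killed.\<close>
  have a_step: "a (Suc n) \<le> a n - l n" for n
  proof -
    have "(\<Sum>u\<in>words (Suc n). of_bool (stays_below v H u) * \<Psi> (v u)) \<le>
        (\<Sum>u\<in>words n. 2 * (of_bool (stays_below v H u) * (\<Psi> (v u) - loss (v u))))"
      unfolding sum_words_Suc
    proof (rule sum_mono)
      fix u :: "bool list"
      show "of_bool (stays_below v H (True # u)) * \<Psi> (v (True # u)) +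
          of_bool (stays_below v H (False # u)) * \<Psi> (v (False # u)) \<le>
          2 * (of_bool (stays_below v H u) * (\<Psi> (v u) - loss (v u)))"
      proof (cases "stays_below v H u")
        case True
        then have le: "v u \<le> H" by (rule stays_below_le)
        have "v (True # u) \<le> H + D" "v (False # u) \<le> H + D"
          using le t(2)[of u] c(1)[of u] by (simp_all add: vT vF)
        then have "0 \<le> \<Psi> (v (True # u))" "0 \<le> \<Psi> (v (False # u))" by (auto intro: \<Psi>_nonneg)
        with step[OF le] True show ?thesis by (auto simp: of_bool_def)
      qed simp
    qed
    also have "\<dots> = 2 * ((\<Sum>u\<in>words n. of_bool (stays_below v H u) * \<Psi> (v u)) -
        (\<Sum>u\<in>words n. of_bool (stays_below v H u) * loss (v u)))"
      by (simp only: sum_distrib_left sum_subtractf right_diff_distrib)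
    finally show ?thesis
      unfolding a_def l_def by (simp add: field_simps)
  qed
  \<comment> \<open>A nonnegative decreasing sequence has vanishing differences, and these dominate
    \<open>l\<close>.\<close>
  have "decseq a" using a_step l_nonneg by (intro decseq_SucI) (smt (verit))
  then obtain a' where "a \<longlonglongrightarrow> a'"
    using a_nonneg by (metis decseq_convergent)
  then have "(\<lambda>n. a n - a (Suc n)) \<longlonglongrightarrow> a' - a'"
    by (intro tendsto_diff LIMSEQ_Suc)
  then have "(\<lambda>n. a n - a (Suc n)) \<longlonglongrightarrow> 0" by simp
  then have l0: "l \<longlonglongrightarrow> 0"
    by (rule tendsto_sandwich[OF _ _ tendsto_const, rotated 2])
      (use a_step l_nonneg in \<open>auto simp: algebra_simps\<close>)
  have a0: "a n \<le> a 0" for n using \<open>decseq a\<close> by (simp add: decseqD)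
  \<comment> \<open>Survivors within distance \<open>R\<close> of \<open>h\<close> have a loss
    bounded below and are counted by \<open>l n\<close>; the others have
    \<open>\<Psi> \<ge> \<eta> * ln R\<close> and are counted by Markov's inequality.\<close>
  have bound: "survival v H n \<le> a 0 / (\<eta> * ln R) + 2 * R\<^sup>2 / (\<eta> * \<delta>\<^sup>2) * l n" if R: "R > 1" for R n
  proof -
    have "(\<Sum>u\<in>words n. of_bool (stays_below v H u)) \<le>
      (\<Sum>u\<in>words n. of_bool (stays_below v H u) * (\<Psi> (v u) / (\<eta> * ln R) + 2 * R\<^sup>2 / (\<eta> * \<delta>\<^sup>2) * loss (v u)))"
    proof (rule sum_mono)
      fix u :: "bool list"
      have "1 \<le> \<Psi> (v u) / (\<eta> * ln R) + 2 * R\<^sup>2 / (\<eta> * \<delta>\<^sup>2) * loss (v u)" if "v u \<le> H"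
      proof (cases "h - v u \<le> R")
        case True
        have "(h - v u)\<^sup>2 \<le> R\<^sup>2" using True that D0 by (intro power_mono) (auto simp: h_def)
        then have "1 \<le> R\<^sup>2 / (h - v u)\<^sup>2" using that D0 by (simp add: h_def)
        also have "\<dots> = 2 * R\<^sup>2 / (\<eta> * \<delta>\<^sup>2) * loss (v u)"
          using \<eta> \<delta> by (simp add: loss_def)
        finally show ?thesis using \<Psi>_nonneg[of "v u"] that D0 \<eta> R by (simp add: add_increasing)
      next
        case False
        have "\<eta> * ln R \<le> \<Psi> (v u)"
          unfolding \<Psi>_def using False R \<eta> that D0
          by (intro add_increasing mult_left_mono) (auto simp: h_def)
        then have "1 \<le> \<Psi> (v u) / (\<eta> * ln R)" using \<eta> R by simp
        moreover have "0 \<le> 2 * R\<^sup>2 / (\<eta> * \<delta>\<^sup>2) * loss (v u)" using \<eta> by (simp add: loss_def)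
        ultimately show ?thesis by linarith
      qed
      then show "of_bool (stays_below v H u) \<le> of_bool (stays_below v H u) *
          (\<Psi> (v u) / (\<eta> * ln R) + 2 * R\<^sup>2 / (\<eta> * \<delta>\<^sup>2) * loss (v u))"
        using stays_below_le[of v H u] by (auto simp: of_bool_def)
    qed
    also have "\<dots> = (\<Sum>u\<in>words n. of_bool (stays_below v H u) * \<Psi> (v u)) / (\<eta> * ln R) +
        2 * R\<^sup>2 / (\<eta> * \<delta>\<^sup>2) * (\<Sum>u\<in>words n. of_bool (stays_below v H u) * loss (v u))"
      by (simp add: sum_divide_distrib sum_distrib_left sum.distrib algebra_simps
          del: sum_of_bool_mult_eq sum_mult_of_bool_eq)
    finally have "(\<Sum>u\<in>words n. of_bool (stays_below v H u)) / 2 ^ n \<le>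
      ((\<Sum>u\<in>words n. of_bool (stays_below v H u) * \<Psi> (v u)) / (\<eta> * ln R) +
        2 * R\<^sup>2 / (\<eta> * \<delta>\<^sup>2) * (\<Sum>u\<in>words n. of_bool (stays_below v H u) * loss (v u))) / 2 ^ n"
      by (intro divide_right_mono) auto
    then have "survival v H n \<le> a n / (\<eta> * ln R) + 2 * R\<^sup>2 / (\<eta> * \<delta>\<^sup>2) * l n"
      unfolding survival_def a_def l_def by (simp add: add_divide_distrib mult.commute)
    also have "\<dots> \<le> a 0 / (\<eta> * ln R) + 2 * R\<^sup>2 / (\<eta> * \<delta>\<^sup>2) * l n"
      using a0[of n] \<eta> R by (intro add_right_mono divide_right_mono) auto
    finally show ?thesis .
  qed
  show ?thesis
  proof (rule LIMSEQ_I)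
    fix e :: real assume e: "0 < e"
    \<comment> \<open>Makes the Markov term at most \<open>e / 2\<close>; the \<open>+ 1\<close>
      ensures \<open>R > 1\<close> even if \<open>a 0 = 0\<close>.\<close>
    define R where "R = exp (2 * (a 0 + 1) / (\<eta> * e))"
    have R: "R > 1" using a_nonneg[of 0] \<eta> e unfolding R_def by (subst one_less_exp_iff) auto
    have "\<eta> * ln R = 2 * (a 0 + 1) / e" using \<eta> by (simp add: R_def)
    then have 1: "a 0 / (\<eta> * ln R) \<le> e / 2"
      using a_nonneg[of 0] e by (simp add: pos_divide_le_eq)
    have "(\<lambda>n. 2 * R\<^sup>2 / (\<eta> * \<delta>\<^sup>2) * l n) \<longlonglongrightarrow> 2 * R\<^sup>2 / (\<eta> * \<delta>\<^sup>2) * 0"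
      by (intro tendsto_mult_left l0)
    then have "\<forall>\<^sub>F n in sequentially. 2 * R\<^sup>2 / (\<eta> * \<delta>\<^sup>2) * l n < e / 2"
      using e by (intro order_tendstoD) auto
    then obtain N where N: "\<And>n. n \<ge> N \<Longrightarrow> 2 * R\<^sup>2 / (\<eta> * \<delta>\<^sup>2) * l n < e / 2"
      unfolding eventually_sequentially by blast
    show "\<exists>N. \<forall>n\<ge>N. norm (survival v H n - 0) < e"
    proof (intro exI allI impI)
      fix n assume "n \<ge> N"
      then show "norm (survival v H n - 0) < e"
        using N[of n] 1 bound[OF R, of n] survival_nonneg[of v H n]
        unfolding diff_0_right real_norm_def by linarith
    qed
  qed
qed

text \<open>Here \<open>\<Phi> w = - w + \<beta> exp w - K\<close> is a submartingale up to the passage above \<open>H\<close>, at which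
  it is nonpositive; as it grows at most linearly, the walk survives long enough.\<close>

lemma survival_lower_bound:
  fixes \<delta> D A H :: real
  assumes \<delta>: "0 < \<delta>" and D: "0 < D" and A: "0 < A"
  obtains R a where "0 < a"
    and "\<And>v c t n. v [] = - R \<Longrightarrow> (\<And>u. v (True # u) = v u + c u + t u) \<Longrightarrow>
      (\<And>u. v (False # u) = v u + c u - t u) \<Longrightarrow> (\<And>u. \<delta> \<le> \<bar>t u\<bar>) \<Longrightarrow> (\<And>u. \<bar>t u\<bar> \<le> D) \<Longrightarrow>
      (\<And>u. 0 \<le> c u) \<Longrightarrow> (\<And>u. c u \<le> 1) \<Longrightarrow> (\<And>u. c u \<le> A * exp (v u)) \<Longrightarrow>
      1 / (a + D * real n) \<le> survival v H n"
proof -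
  define \<kappa> where "\<kappa> = cosh \<delta> - 1"
  have \<kappa>: "\<kappa> > 0" using \<delta> cosh_real_nonneg_less_iff[of 0 \<delta>] by (simp add: \<kappa>_def)
  \<comment> \<open>The mean growth of \<open>\<beta> * exp w\<close> is at least
    \<open>\<beta> * \<kappa> * exp w = A * exp w\<close>, which pays for the upward drift in
    \<open>- w\<close>.\<close>
  define \<beta> where "\<beta> = A / \<kappa>"
  have \<beta>: "\<beta> > 0" using A \<kappa> by (simp add: \<beta>_def)
  \<comment> \<open>A step is at most \<open>D + 1\<close>, so a killed walk lands between
    \<open>H\<close> and \<open>H + D + 1\<close>, where this constant makes
    \<open>\<Phi> \<le> 0\<close>.\<close>
  define K where "K = - H + \<beta> * exp (H + D + 1)"
  define \<Phi> where "\<Phi> = (\<lambda>w. - w + \<beta> * exp w - K)"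
  define a where "a = 1 + \<beta> * exp H"
  have a: "a > 0" using \<beta> by (simp add: a_def add_pos_pos)
  \<comment> \<open>The witness for \<open>R\<close> is \<open>K + 1\<close>, which gives
    \<open>\<Phi> \<ge> 1\<close> at the start.\<close>
  have "1 / (a + D * real n) \<le> survival v H n"
    if v0: "v [] = - (K + 1)" and vT: "\<And>u. v (True # u) = v u + c u + t u"
    and vF: "\<And>u. v (False # u) = v u + c u - t u"
    and t: "\<And>u. \<delta> \<le> \<bar>t u\<bar>" "\<And>u. \<bar>t u\<bar> \<le> D"
    and c: "\<And>u. 0 \<le> c u" "\<And>u. c u \<le> 1" "\<And>u. c u \<le> A * exp (v u)"
  for v c t :: "bool list \<Rightarrow> real" and n
  proof -
    have step: "\<Phi> (v u) \<le> (\<Phi> (v (True # u)) + \<Phi> (v (False # u))) / 2" for u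
    proof -
      have "exp (v u) * (1 + \<kappa>) \<le> exp (v u) * (exp (c u) * cosh (t u))"
      proof (intro mult_left_mono)
        have "1 * cosh \<delta> \<le> exp (c u) * cosh (t u)"
          using c(1)[of u] t \<delta> by (intro mult_mono cosh_ge_of_abs_ge) auto
        then show "1 + \<kappa> \<le> exp (c u) * cosh (t u)" by (simp add: \<kappa>_def)
      qed simp
      also have "\<dots> = (exp (v (True # u)) + exp (v (False # u))) / 2"
        by (simp add: vT vF cosh_def exp_add exp_diff exp_minus field_simps)
      finally have "\<beta> * (exp (v u) * (1 + \<kappa>)) \<le> \<beta> * ((exp (v (True # u)) + exp (v (False # u))) / 2)"
        using \<beta> by (intro mult_left_mono) auto
      moreover have "\<beta> * (exp (v u) * (1 + \<kappa>)) = \<beta> * exp (v u) + A * exp (v u)"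
        using \<kappa> by (simp add: \<beta>_def field_simps)
      ultimately have "\<beta> * exp (v u) + c u \<le> (\<beta> * exp (v (True # u)) + \<beta> * exp (v (False # u))) / 2"
        using c(3)[of u] by (simp only: times_divide_eq_right distrib_left[of \<beta>])
      moreover have "v (True # u) + v (False # u) = 2 * v u + 2 * c u" by (simp add: vT vF)
      ultimately show ?thesis
        unfolding \<Phi>_def by (simp only: add_divide_distrib diff_divide_distrib)
    qed
    have dead: "\<Phi> w \<le> 0" if "w > H" "w \<le> H + D + 1" for w
    proof -
      have "\<beta> * exp w \<le> \<beta> * exp (H + D + 1)" using that \<beta> by (intro mult_left_mono) auto
      then show ?thesis using that by (simp add: \<Phi>_def K_def)
    qed
    define b where "b n = (\<Sum>u\<in>words n. of_bool (stays_below v H u) * \<Phi> (v u)) / 2 ^ n" for n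
    \<comment> \<open>Dropping killed words cannot lower the expectation, since
      \<open>\<Phi> \<le> 0\<close> on them.\<close>
    have b_step: "b n \<le> b (Suc n)" for n
    proof -
      have "(\<Sum>u\<in>words n. 2 * (of_bool (stays_below v H u) * \<Phi> (v u))) \<le>
        (\<Sum>u\<in>words (Suc n). of_bool (stays_below v H u) * \<Phi> (v u))"
        unfolding sum_words_Suc
      proof (rule sum_mono)
        fix u :: "bool list"
        show "2 * (of_bool (stays_below v H u) * \<Phi> (v u)) \<le>
          of_bool (stays_below v H (True # u)) * \<Phi> (v (True # u)) +
          of_bool (stays_below v H (False # u)) * \<Phi> (v (False # u))"
        proof (cases "stays_below v H u")
          case True
          then have le: "v u \<le> H" by (rule stays_below_le)
          have "v (True # u) \<le> H + D + 1" "v (False # u) \<le> H + D + 1"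
            using le t(2)[of u] c(2)[of u] by (simp_all add: vT vF)
          then have "v (True # u) > H \<Longrightarrow> \<Phi> (v (True # u)) \<le> 0"
            "v (False # u) > H \<Longrightarrow> \<Phi> (v (False # u)) \<le> 0" by (auto intro: dead)
          with step[of u] True show ?thesis by (auto simp: of_bool_def)
        qed simp
      qed
      then show ?thesis
        unfolding b_def by (simp add: sum_distrib_left[symmetric] field_simps)
    qed
    have "\<beta> * exp (H + D + 1) > 0" using \<beta> by simp
    then have "v [] \<le> H" unfolding v0 K_def by linarith
    then have "b 0 \<ge> 1" using \<beta> by (simp add: b_def v0 \<Phi>_def)
    moreover have "b 0 \<le> b n" using b_step by (simp add: lift_Suc_mono_le)
    ultimately have "1 \<le> b n" by linarith
    also have "b n \<le> (a + D * real n) * survival v H n"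
    proof -
      \<comment> \<open>A step descends by at most \<open>D\<close>, so
        \<open>\<Phi> \<le> a + D * real n\<close> on survivors; dividing \<open>1 \<le> b n\<close>
        by this gives the bound.\<close>
      have low: "v u \<ge> - (K + 1) - D * real (length u)" for u
      proof (induction u)
        case Nil then show ?case by (simp add: v0)
      next
        case (Cons x u)
        then show ?case using t(2)[of u] c(1)[of u] by (cases x) (simp_all add: vT vF algebra_simps)
      qed
      have "(\<Sum>u\<in>words n. of_bool (stays_below v H u) * \<Phi> (v u)) \<le>
          (\<Sum>u\<in>words n. (a + D * real n) * of_bool (stays_below v H u))"
      proof (rule sum_mono)
        fix u assume u: "u \<in> words n"
        have "\<Phi> (v u) \<le> a + D * real n" if "v u \<le> H"
        proof -
          have "\<beta> * exp (v u) \<le> \<beta> * exp H" using that \<beta> by (intro mult_left_mono) auto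
          then show ?thesis using low[of u] u by (simp add: \<Phi>_def a_def length_words)
        qed
        then show "of_bool (stays_below v H u) * \<Phi> (v u) \<le> (a + D * real n) * of_bool (stays_below v H u)"
          using stays_below_le[of v H u] by (auto simp: of_bool_def)
      qed
      then show ?thesis
        unfolding b_def survival_def by (simp add: sum_distrib_left[symmetric] divide_right_mono)
    qed
    finally show ?thesis using a D by (simp add: field_simps add_pos_nonneg)
  qed
  with a show ?thesis by (rule that)
qed

section \<open>Binary digits and the doubling map\<close>

text \<open>The inverse branches of the doubling map, indexed by the digit they prepend.\<close>

definition half_branch :: "bool \<Rightarrow> real \<Rightarrow> real" where
  "half_branch b z = (of_bool b + z) / 2"

text \<open>The most recent binary digit comes first.\<close>

primrec digits :: "nat \<Rightarrow> real \<Rightarrow> bool list" where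
  "digits 0 y = []"
| "digits (Suc n) y = (1 / 2 \<le> (doubling ^^ n) y) # digits n y"

text \<open>Left end of the dyadic interval coded by the word; the head, being the latest digit, has
  the smallest weight.\<close>

primrec left_end :: "bool list \<Rightarrow> real" where
  "left_end [] = 0"
| "left_end (b # u) = left_end u + of_bool b / 2 ^ Suc (length u)"

lemma length_digits [simp]: "length (digits n y) = n"
  by (induction n) auto

lemma half_branch_in: "z \<in> {0..1} \<Longrightarrow> half_branch b z \<in> {0..1}"
  by (auto simp: half_branch_def)

text \<open>The point 1 is excluded here and in the digit coding below because
  \<open>doubling 1 = 0\<close>, while the right-hand side would be 1.\<close>

lemma doubling_eq:
  assumes "t \<in> {0..<1}" shows "doubling t = 2 * t - of_bool (1 / 2 \<le> t)"
proof (cases "1 / 2 \<le> t")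
  case True
  with assms have "\<lfloor>2 * t\<rfloor> = 1" by (intro floor_unique) auto
  with True show ?thesis by (simp add: doubling_def)
next
  case False
  with assms have "\<lfloor>2 * t\<rfloor> = 0" by (intro floor_unique) auto
  with False show ?thesis by (simp add: doubling_def)
qed

lemma doubling_in: "t \<in> {0..<1} \<Longrightarrow> doubling t \<in> {0..<1}"
  by (cases "1 / 2 \<le> t") (auto simp: doubling_eq)

lemma doubling_funpow_in: "y \<in> {0..<1} \<Longrightarrow> (doubling ^^ n) y \<in> {0..<1}"
  by (induction n) (auto simp del: atLeastLessThan_iff intro: doubling_in)

lemma half_branch_doubling: "t \<in> {0..<1} \<Longrightarrow> half_branch (1 / 2 \<le> t) (doubling t) = t"
  by (simp add: doubling_eq half_branch_def)

lemma left_end_digits: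
  "y \<in> {0..<1} \<Longrightarrow> y = left_end (digits n y) + (doubling ^^ n) y / 2 ^ n"
proof (induction n)
  case (Suc n)
  have "(doubling ^^ n) y = half_branch (1 / 2 \<le> (doubling ^^ n) y) (doubling ((doubling ^^ n) y))"
    using half_branch_doubling[OF doubling_funpow_in[OF Suc.prems, of n]] by simp
  then have "(doubling ^^ n) y / 2 ^ n =
      (of_bool (1 / 2 \<le> (doubling ^^ n) y) + (doubling ^^ Suc n) y) / 2 ^ Suc n"
    by (simp add: half_branch_def)
  with Suc show ?case by (simp add: add_divide_distrib)
qed simp

text \<open>Forward, the part of the expansion after \<open>u\<close> contributes less than one
  interval length. Backward, the interval of \<open>b # u\<close> is one half of that of
  \<open>u\<close>: induction gives the older digits, and the choice of half gives
  \<open>b\<close>.\<close>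

lemma digits_eq_iff:
  assumes "y \<in> {0..<1}"
  shows "digits (length u) y = u \<longleftrightarrow> left_end u \<le> y \<and> y < left_end u + 1 / 2 ^ length u"
proof
  assume "digits (length u) y = u"
  then have "y = left_end u + (doubling ^^ length u) y / 2 ^ length u"
    using left_end_digits[OF assms, of "length u"] by simp
  with doubling_funpow_in[OF assms, of "length u"]
  have "y = left_end u + (doubling ^^ length u) y / 2 ^ length u"
    "0 \<le> (doubling ^^ length u) y" "(doubling ^^ length u) y < 1" by auto
  then show "left_end u \<le> y \<and> y < left_end u + 1 / 2 ^ length u"
    by (smt (verit) divide_nonneg_pos divide_strict_right_mono zero_less_power)
next
  show "left_end u \<le> y \<and> y < left_end u + 1 / 2 ^ length u \<Longrightarrow> digits (length u) y = u"
  proof (induction u)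
    case (Cons b u)
    let ?n = "length u" and ?t = "(doubling ^^ length u) y"
    have p: "(2::real) ^ ?n > 0" by simp
    have b01: "0 \<le> (of_bool b :: real)" "(of_bool b :: real) \<le> 1" by auto
    have lo: "left_end u + of_bool b / 2 / 2 ^ ?n \<le> y"
      and hi: "y < left_end u + (of_bool b + 1) / 2 / 2 ^ ?n"
      using Cons.prems by (simp_all add: add_divide_distrib algebra_simps)
    have "0 \<le> (of_bool b :: real) / 2 / 2 ^ ?n" by simp
    moreover have "((of_bool b :: real) + 1) / 2 / 2 ^ ?n \<le> 1 / 2 ^ ?n"
      using b01 by (intro divide_right_mono) auto
    ultimately have u: "digits ?n y = u" using Cons.IH lo hi by linarith
    have y: "y = left_end u + ?t / 2 ^ ?n" using left_end_digits[OF assms, of ?n] u by simp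
    have "of_bool b / 2 / 2 ^ ?n \<le> ?t / 2 ^ ?n" "?t / 2 ^ ?n < (of_bool b + 1) / 2 / 2 ^ ?n"
      using lo hi y by linarith+
    then have "of_bool b / 2 \<le> ?t" "?t < (of_bool b + 1) / 2"
      using p by (simp_all only: divide_le_cancel divide_less_cancel)
    then have "(1 / 2 \<le> ?t) = b" by (cases b) auto
    with u show ?case by simp
  qed simp
qed

lemma stays_below_digits:
  "j \<le> n \<Longrightarrow> stays_below v H (digits n y) \<Longrightarrow> stays_below v H (digits j y)"
  by (induction n rule: dec_induct) auto

lemma funpow_add_apply: "(f ^^ (N + n)) y = (f ^^ n) ((f ^^ N) y)"
  by (subst add.commute) (simp add: funpow_add)

lemma digits_add: "digits (N + n) y = digits n ((doubling ^^ N) y) @ digits N y"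
  by (induction n) (simp_all add: funpow_add_apply)

text \<open>\<open>of_bool b\<close> is the fixed point of \<open>half_branch b\<close>. While the
  digit is \<open>b\<close>, a step exactly doubles the distance to it, and at time \<open>N\<close>
  this distance is at most 1; hence the induction runs downward from \<open>N\<close>.\<close>

lemma dist_fixed_point:
  assumes y: "y \<in> {0..<1}" and dig: "digits N y = replicate N b" and "i \<le> N"
  shows "\<bar>(doubling ^^ i) y - of_bool b\<bar> \<le> 2 ^ i / 2 ^ N"
  using \<open>i \<le> N\<close>
proof (induction i rule: inc_induct)
  case base
  then show ?case using doubling_funpow_in[OF y, of N] by (cases b) auto
next
  case (step i)
  have "digits (Suc i) y = replicate (Suc i) b"
  proof -
    have "drop (N - Suc i) (digits N y) = digits (Suc i) y"
      using digits_add[of "Suc i" "N - Suc i" y] step.hyps by (simp del: digits.simps)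
    moreover have "drop (N - Suc i) (replicate N b) = replicate (Suc i) b"
      using step.hyps by (simp del: replicate_Suc)
    ultimately show ?thesis by (simp only: dig)
  qed
  then have "(1 / 2 \<le> (doubling ^^ i) y) = b" by (simp only: digits.simps replicate_Suc list.inject)
  then have "(doubling ^^ Suc i) y - of_bool b = 2 * ((doubling ^^ i) y - of_bool b)"
    using doubling_eq[OF doubling_funpow_in[OF y, of i]] by simp
  then have "\<bar>(doubling ^^ Suc i) y - of_bool b\<bar> = 2 * \<bar>(doubling ^^ i) y - of_bool b\<bar>"
    by (simp only: abs_mult abs_numeral)
  with step.IH show ?case by simp
qed

section \<open>Lebesgue measure of cylinders and averages over inverse branches\<close>

lemma left_end_bounds: "0 \<le> left_end u \<and> left_end u + 1 / 2 ^ length u \<le> 1"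
proof (induction u)
  case (Cons b u)
  have "(of_bool b :: real) / 2 ^ Suc (length u) + 1 / 2 ^ Suc (length u) \<le> 1 / 2 ^ length u"
    by (cases b) (auto simp: field_simps)
  with Cons show ?case by (auto simp: add_nonneg_nonneg)
qed simp

text \<open>An event in the first \<open>n\<close> digits is a disjoint union of dyadic intervals of
  length \<open>1 / 2 ^ n\<close>. This identifies \<open>survival\<close> with a Lebesgue
  measure.\<close>

lemma
  shows sets_cylinders: "{y \<in> {0..<1}. P (digits n y)} \<in> sets lebesgue"
    and emeasure_cylinders: "emeasure lebesgue {y \<in> {0..<1}. P (digits n y)} =
      ennreal ((\<Sum>u\<in>words n. of_bool (P u)) / 2 ^ n)"
proof -
  define J where "J u = {left_end u..<left_end u + 1 / 2 ^ n}" for u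
  define W where "W = {u \<in> words n. P u}"
  have J: "y \<in> J u \<longleftrightarrow> y \<in> {0..<1} \<and> digits n y = u" if "u \<in> words n" for u y
    using that left_end_bounds[of u] digits_eq_iff[of y u] by (auto simp: J_def words_def)
  have eq: "{y \<in> {0..<1}. P (digits n y)} = (\<Union>u\<in>W. J u)"
    using J by (auto simp: W_def) (auto simp: words_def)
  have fin: "finite W" by (simp add: W_def)
  have Jsets: "J u \<in> sets lebesgue" for u unfolding J_def by simp
  then show "{y \<in> {0..<1}. P (digits n y)} \<in> sets lebesgue"
    unfolding eq using fin by (intro sets.finite_UN) auto
  have "disjoint_family_on J W"
    unfolding disjoint_family_on_def using J by (auto simp: W_def)
  then have "emeasure lebesgue (\<Union>u\<in>W. J u) = (\<Sum>u\<in>W. emeasure lebesgue (J u))"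
    using fin Jsets by (intro sum_emeasure[symmetric]) auto
  also have "\<dots> = (\<Sum>u\<in>W. ennreal (1 / 2 ^ n))" by (simp add: J_def)
  also have "\<dots> = ennreal (\<Sum>u\<in>W. 1 / 2 ^ n)" by (rule sum_ennreal) simp
  also have "(\<Sum>u\<in>W. 1 / 2 ^ n) = (\<Sum>u\<in>words n. of_bool (P u)) / (2 ^ n :: real)"
    by (simp add: W_def sum_divide_distrib Int_def)
  finally show "emeasure lebesgue {y \<in> {0..<1}. P (digits n y)} =
      ennreal ((\<Sum>u\<in>words n. of_bool (P u)) / 2 ^ n)" unfolding eq .
qed

text \<open>Each branch is an affine change of variables onto one half of the unit interval. In
  other words, the transfer operator of the doubling map preserves the integral.\<close>

lemma integral_half_branches:
  fixes f :: "real \<Rightarrow> real"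
  assumes f: "continuous_on {0..1} f"
  shows "integral {0..1} (\<lambda>z. f (half_branch True z)) + integral {0..1} (\<lambda>z. f (half_branch False z)) =
    2 * integral {0..1} f"
proof -
  have int: "f integrable_on {0..1}" using f by (rule integrable_continuous_real)
  have *: "integral {0..1} (\<lambda>z. f (half_branch b z)) = 2 * integral {of_bool b / 2..(of_bool b + 1) / 2} f" for b
  proof -
    have "f integrable_on {of_bool b / 2..(of_bool b + 1) / 2}"
      by (rule integrable_on_subinterval[OF int]) auto
    then have "(f has_integral integral {of_bool b / 2..(of_bool b + 1) / 2} f)
        (cbox (of_bool b / 2) ((of_bool b + 1) / 2))"
      by (simp add: integrable_integral)
    from has_integral_affinity'[OF this, of "1/2" "of_bool b / 2"]
    have "((\<lambda>z. f (half_branch b z)) has_integral 2 * integral {of_bool b / 2..(of_bool b + 1) / 2} f) {0..1}"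
      by (simp add: half_branch_def add_divide_distrib add.commute)
    then show ?thesis by (rule integral_unique)
  qed
  have "integral {0..1 / 2} f + integral {1 / 2..1} f = integral {0..1} f"
    by (rule Henstock_Kurzweil_Integration.integral_combine) (use int in auto)
  then show ?thesis by (simp add: *)
qed

lemma half_branch_continuous: "continuous_on S (half_branch b)"
  unfolding half_branch_def by (intro continuous_intros) auto

lemma continuous_half_branch:
  "continuous_on {0..1} f \<Longrightarrow> continuous_on {0..1} (\<lambda>z. f (half_branch b z))"
  by (rule continuous_on_compose2[OF _ half_branch_continuous]) (use half_branch_in in auto)

lemma integral_lower:
  fixes f :: "real \<Rightarrow> real"
  assumes "continuous_on {0..1} f" "\<And>y. y \<in> {0..1} \<Longrightarrow> a \<le> f y"
  shows "a \<le> integral {0..1} f"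
proof -
  have "integral {0..1::real} (\<lambda>_. a) \<le> integral {0..1} f"
    using assms by (intro integral_le integrable_continuous_real) auto
  then show ?thesis by simp
qed

lemma integral_upper:
  fixes f :: "real \<Rightarrow> real"
  assumes "continuous_on {0..1} f" "\<And>y. y \<in> {0..1} \<Longrightarrow> f y \<le> b"
  shows "integral {0..1} f \<le> b"
proof -
  have "integral {0..1} f \<le> integral {0..1::real} (\<lambda>_. b)"
    using assms by (intro integral_le integrable_continuous_real) auto
  then show ?thesis by simp
qed

section \<open>Birkhoff sums and their conditional expectations\<close>

text \<open>Here \<open>z\<close> is the point reached after the digits \<open>u\<close>, and the
  earlier orbit is recovered through inverse branches. For fixed \<open>u\<close> the sum thus
  depends only on the unread digits.\<close>

primrec birkhoff :: "(real \<Rightarrow> real) \<Rightarrow> bool list \<Rightarrow> real \<Rightarrow> real" where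
  "birkhoff \<xi> [] z = 0"
| "birkhoff \<xi> (b # u) z = birkhoff \<xi> u (half_branch b z) + \<xi> (half_branch b z)"

definition birkhoff_at :: "(real \<Rightarrow> real) \<Rightarrow> nat \<Rightarrow> real \<Rightarrow> real" where
  "birkhoff_at \<xi> n y = birkhoff \<xi> (digits n y) ((doubling ^^ n) y)"

lemma birkhoff_at_0 [simp]: "birkhoff_at \<xi> 0 y = 0"
  by (simp add: birkhoff_at_def)

lemma birkhoff_at_Suc:
  assumes "y \<in> {0..<1}"
  shows "birkhoff_at \<xi> (Suc n) y = birkhoff_at \<xi> n y + \<xi> ((doubling ^^ n) y)"
  using half_branch_doubling[OF doubling_funpow_in[OF assms, of n]] by (simp add: birkhoff_at_def)

text \<open>Conditional expectation of the Birkhoff sum given the digits \<open>u\<close>: under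
  Lebesgue measure the point reached after them is uniform on the unit interval.\<close>

definition mean_sum :: "(real \<Rightarrow> real) \<Rightarrow> bool list \<Rightarrow> real" where
  "mean_sum \<xi> u = integral {0..1} (birkhoff \<xi> u)"

lemma mean_sum_Nil [simp]: "mean_sum \<xi> [] = 0"
  by (simp add: mean_sum_def birkhoff.simps[abs_def])

text \<open>The sign \<open>\<sigma>\<close> is \<open>1\<close> or \<open>-1\<close> as \<open>\<xi>\<close> increases or decreases; \<open>gap\<close> is the quantitative form of
  strict monotonicity that keeps the martingale increments away from zero.\<close>

locale mean_zero_base =
  fixes \<xi> :: "real \<Rightarrow> real" and \<sigma> L k \<delta> :: real
  assumes lip: "\<And>y z. y \<in> {0..1} \<Longrightarrow> z \<in> {0..1} \<Longrightarrow> \<bar>\<xi> y - \<xi> z\<bar> \<le> L * \<bar>y - z\<bar>"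
    and bound: "\<And>y. y \<in> {0..1} \<Longrightarrow> \<bar>\<xi> y\<bar> \<le> k"
    and sign: "\<bar>\<sigma>\<bar> = 1"
    and mono: "\<And>y z. 0 \<le> y \<Longrightarrow> y \<le> z \<Longrightarrow> z \<le> 1 \<Longrightarrow> \<sigma> * \<xi> y \<le> \<sigma> * \<xi> z"
    and gap: "\<And>z. z \<in> {0..1} \<Longrightarrow> 2 * \<delta> \<le> \<sigma> * (\<xi> (half_branch True z) - \<xi> (half_branch False z))"
    and mean_zero: "integral {0..1} \<xi> = 0"
    and delta_pos: "0 < \<delta>"
begin

lemma L_nonneg: "0 \<le> L"
  using lip[of 0 1] by simp

lemma continuous_of_lip:
  fixes f :: "real \<Rightarrow> real"
  assumes "\<And>y z. y \<in> {0..1} \<Longrightarrow> z \<in> {0..1} \<Longrightarrow> \<bar>f y - f z\<bar> \<le> L * \<bar>y - z\<bar>"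
  shows "continuous_on {0..1} f"
  by (rule lipschitz_on_continuous_on[of L], rule lipschitz_onI) (use assms L_nonneg in \<open>auto simp: dist_real_def\<close>)

lemma continuous: "continuous_on {0..1} \<xi>"
  by (rule continuous_of_lip) (rule lip)

text \<open>Inverse branches halve distances, so the Lipschitz constants of the summands form a
  geometric series; \<open>L / 2 + L / 2 = L\<close> closes the induction for every length.\<close>

lemma birkhoff_lip:
  "y \<in> {0..1} \<Longrightarrow> z \<in> {0..1} \<Longrightarrow> \<bar>birkhoff \<xi> u y - birkhoff \<xi> u z\<bar> \<le> L * \<bar>y - z\<bar>"
proof (induction u arbitrary: y z)
  case (Cons b u)
  have h: "half_branch b y \<in> {0..1}" "half_branch b z \<in> {0..1}" using Cons.prems by (simp_all only: half_branch_in)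
  have "\<bar>half_branch b y - half_branch b z\<bar> = \<bar>y - z\<bar> / 2" by (simp add: half_branch_def diff_divide_distrib[symmetric])
  with Cons.IH[OF h] lip[OF h] show ?case
    using abs_triangle_ineq[of "birkhoff \<xi> u (half_branch b y) - birkhoff \<xi> u (half_branch b z)"
        "\<xi> (half_branch b y) - \<xi> (half_branch b z)"] by (simp add: algebra_simps)
qed (use L_nonneg in simp)

lemma birkhoff_continuous: "continuous_on {0..1} (birkhoff \<xi> u)"
  by (rule continuous_of_lip) (rule birkhoff_lip)

lemma birkhoff_mono:
  "0 \<le> y \<Longrightarrow> y \<le> z \<Longrightarrow> z \<le> 1 \<Longrightarrow> \<sigma> * birkhoff \<xi> u y \<le> \<sigma> * birkhoff \<xi> u z"
proof (induction u arbitrary: y z)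
  case (Cons b u)
  then have "0 \<le> half_branch b y" "half_branch b y \<le> half_branch b z" "half_branch b z \<le> 1"
    by (auto simp: half_branch_def)
  with Cons.IH mono show ?case by (simp add: distrib_left add_mono)
qed simp

text \<open>Bounded distortion: this is the bounded price of replacing Birkhoff sums by the
  martingale.\<close>

lemma birkhoff_near_mean:
  assumes z: "z \<in> {0..1}" shows "\<bar>birkhoff \<xi> u z - mean_sum \<xi> u\<bar> \<le> L"
proof -
  have "\<bar>birkhoff \<xi> u y - birkhoff \<xi> u z\<bar> \<le> L" if y: "y \<in> {0..1}" for y
  proof -
    have "L * \<bar>y - z\<bar> \<le> L * 1" using L_nonneg y z by (intro mult_left_mono) auto
    with birkhoff_lip[OF y z, of u] show ?thesis by simp
  qed
  then have "birkhoff \<xi> u z - L \<le> birkhoff \<xi> u y \<and> birkhoff \<xi> u y \<le> birkhoff \<xi> u z + L"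
    if "y \<in> {0..1}" for y using that by (fastforce simp: abs_le_iff)
  then have "birkhoff \<xi> u z - L \<le> mean_sum \<xi> u" "mean_sum \<xi> u \<le> birkhoff \<xi> u z + L"
    unfolding mean_sum_def by (auto intro!: integral_lower integral_upper birkhoff_continuous)
  then show ?thesis by linarith
qed

lemma birkhoff_at_near_mean:
  "y \<in> {0..<1} \<Longrightarrow> \<bar>birkhoff_at \<xi> n y - mean_sum \<xi> (digits n y)\<bar> \<le> L"
  unfolding birkhoff_at_def
  by (rule birkhoff_near_mean) (use doubling_funpow_in[of y n] in auto)

definition increment :: "bool list \<Rightarrow> real" where
  "increment u = mean_sum \<xi> (True # u) - mean_sum \<xi> u"

lemma mean_sum_True: "mean_sum \<xi> (True # u) = mean_sum \<xi> u + increment u"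
  by (simp add: increment_def)

text \<open>The martingale property: by \<open>integral_half_branches\<close> the two children
  average to \<open>mean_sum \<xi> u\<close> plus the mean of \<open>\<xi>\<close>, which is zero.
  Hence the two increments are opposite.\<close>

lemma mean_sum_False: "mean_sum \<xi> (False # u) = mean_sum \<xi> u - increment u"
proof -
  let ?f = "\<lambda>y. birkhoff \<xi> u y + \<xi> y"
  have c: "continuous_on {0..1} ?f" by (intro continuous_intros birkhoff_continuous continuous)
  have "mean_sum \<xi> (True # u) + mean_sum \<xi> (False # u) = 2 * integral {0..1} ?f"
    using integral_half_branches[OF c] by (simp add: mean_sum_def birkhoff.simps[abs_def])
  also have "integral {0..1} ?f = mean_sum \<xi> u + integral {0..1} \<xi>"
    unfolding mean_sum_def
    by (intro integral_add integrable_continuous_real birkhoff_continuous continuous)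
  finally show ?thesis by (simp add: increment_def mean_zero)
qed

text \<open>The older summands contribute to the difference of the children with the sign of
  \<open>\<sigma>\<close>, by monotonicity, so they cannot cancel the \<open>2 * \<delta>\<close>
  that \<open>gap\<close> gives for the newest summand.\<close>

lemma increment_lower: "\<delta> \<le> \<bar>increment u\<bar>"
proof -
  let ?f = "\<lambda>b z. birkhoff \<xi> (b # u) z"
  have "2 * \<delta> \<le> integral {0..1} (\<lambda>z. \<sigma> * (?f True z - ?f False z))"
  proof (rule integral_lower)
    show "continuous_on {0..1} (\<lambda>z. \<sigma> * (?f True z - ?f False z))"
      by (intro continuous_on_mult_left continuous_on_diff birkhoff_continuous)
    show "2 * \<delta> \<le> \<sigma> * (?f True z - ?f False z)" if "z \<in> {0..1}" for z
    proof -
      have "\<sigma> * birkhoff \<xi> u (half_branch False z) \<le> \<sigma> * birkhoff \<xi> u (half_branch True z)"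
        using that by (intro birkhoff_mono) (auto simp: half_branch_def)
      with gap[OF that] show ?thesis by (simp add: algebra_simps)
    qed
  qed
  also have "\<dots> = \<sigma> * (mean_sum \<xi> (True # u) - mean_sum \<xi> (False # u))"
    unfolding mean_sum_def
    by (simp only: integral_mult_right integral_diff integrable_continuous_real birkhoff_continuous)
  also have "\<dots> = 2 * (\<sigma> * increment u)" by (simp add: mean_sum_True mean_sum_False)
  also have "\<dots> \<le> 2 * \<bar>increment u\<bar>"
    using sign abs_ge_self[of "\<sigma> * increment u"] by (simp add: abs_mult)
  finally show ?thesis by simp
qed

text \<open>\<open>L\<close> is the distortion of the old sum, \<open>k\<close> the size of the new
  summand.\<close>

lemma increment_upper: "\<bar>increment u\<bar> \<le> L + k"
proof -
  let ?f = "birkhoff \<xi> (True # u)"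
  have "\<bar>?f z - mean_sum \<xi> u\<bar> \<le> L + k" if "z \<in> {0..1}" for z
    using birkhoff_near_mean[OF half_branch_in[OF that], of u True]
      bound[OF half_branch_in[OF that], of True] by simp
  then have "mean_sum \<xi> u - (L + k) \<le> ?f z \<and> ?f z \<le> mean_sum \<xi> u + (L + k)" if "z \<in> {0..1}" for z
    using that by (fastforce simp: abs_le_iff simp del: birkhoff.simps)
  then have "mean_sum \<xi> u - (L + k) \<le> integral {0..1} ?f" "integral {0..1} ?f \<le> mean_sum \<xi> u + (L + k)"
    by (auto intro!: integral_lower integral_upper birkhoff_continuous simp del: birkhoff.simps)
  then show ?thesis unfolding increment_def mean_sum_def[of \<xi> "True # u"] by linarith
qed

text \<open>The averages of \<open>\<xi>\<close> over the two halves cancel, while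
  \<open>gap\<close> keeps them apart, so the lower end value of \<open>\<xi>\<close> is at most
  \<open>- \<delta>\<close>. Repeating the corresponding digit drives orbits down.\<close>

lemma exists_descending_digit: "\<exists>b. \<xi> (of_bool b) \<le> - \<delta>"
proof -
  let ?I = "\<lambda>b. integral {0..1} (\<lambda>z. \<sigma> * \<xi> (half_branch b z))"
  have c: "continuous_on {0..1} (\<lambda>z. \<sigma> * \<xi> (half_branch b z))" for b
    by (intro continuous_on_mult_left continuous_half_branch continuous)
  have sum: "?I True + ?I False = 0"
    using integral_half_branches[OF continuous] mean_zero
    by (simp add: distrib_left[symmetric])
  have h: "\<sigma> * \<xi> 0 \<le> \<sigma> * \<xi> (half_branch b z)" "\<sigma> * \<xi> (half_branch b z) \<le> \<sigma> * \<xi> 1"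
    if "z \<in> {0..1}" for b z
    using half_branch_in[OF that, of b] by (auto intro: mono)
  have g: "\<sigma> * \<xi> (half_branch False z) + 2 * \<delta> \<le> \<sigma> * \<xi> (half_branch True z)" if "z \<in> {0..1}" for z
    using gap[OF that] by (simp add: algebra_simps)
  have g': "\<sigma> * \<xi> 0 + 2 * \<delta> \<le> \<sigma> * \<xi> (half_branch True z)"
    "\<sigma> * \<xi> (half_branch False z) \<le> \<sigma> * \<xi> 1 - 2 * \<delta>" if "z \<in> {0..1}" for z
    using g[OF that] h(1)[OF that, of False] h(2)[OF that, of True] by linarith+
  have "\<sigma> * \<xi> 0 \<le> ?I False" "\<sigma> * \<xi> 0 + 2 * \<delta> \<le> ?I True"
    by (rule integral_lower[OF c], erule h g')+
  with sum have 0: "\<sigma> * \<xi> 0 \<le> - \<delta>" by linarith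
  have "?I True \<le> \<sigma> * \<xi> 1" "?I False \<le> \<sigma> * \<xi> 1 - 2 * \<delta>"
    by (rule integral_upper[OF c], erule h g')+
  with sum have 1: "\<delta> \<le> \<sigma> * \<xi> 1" by linarith
  have "\<sigma> = 1 \<or> \<sigma> = - 1" using sign by linarith
  then show ?thesis
  proof
    assume "\<sigma> = 1" with 0 show ?thesis by (intro exI[of _ False]) simp
  next
    assume "\<sigma> = - 1" with 1 show ?thesis by (intro exI[of _ True]) simp
  qed
qed

end

section \<open>The walk in the logit coordinate\<close>

definition logit :: "real \<Rightarrow> real" where
  "logit x = ln (x / (1 - x))"

lemma logit_eq: "x \<in> {0<..<1} \<Longrightarrow> logit x = ln x - ln (1 - x)"
  by (simp add: logit_def ln_div)

lemma exp_logit: "x \<in> {0<..<1} \<Longrightarrow> exp (logit x) = x / (1 - x)"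
  by (simp add: logit_def)

lemma logit_less_iff: "x \<in> {0<..<1} \<Longrightarrow> y \<in> {0<..<1} \<Longrightarrow> logit x < logit y \<longleftrightarrow> x < y"
  by (auto simp: logit_def field_simps)

lemma abs_ln_one_plus_le:
  fixes x :: real assumes "\<bar>x\<bar> \<le> 1 / 2" shows "\<bar>ln (1 + x)\<bar> \<le> 2 * \<bar>x\<bar>"
proof -
  have "2 * x\<^sup>2 = 2 * \<bar>x\<bar> * \<bar>x\<bar>" by (simp add: power2_eq_square abs_mult_self_eq)
  also have "\<dots> \<le> 2 * (1 / 2) * \<bar>x\<bar>" using assms by (intro mult_right_mono) auto
  finally show ?thesis using abs_ln_one_plus_x_minus_x_bound[OF assms] by linarith
qed

text \<open>For \<open>r = 0\<close> the map is exactly translation by \<open>a\<close> in the logit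
  coordinate. The error is the effect of \<open>r\<close> relative to the distances from 0 and 1;
  the quadratic bound on \<open>r\<close> supplies the factor \<open>exp (logit x)\<close> near
  0.\<close>

lemma logit_perturbation:
  fixes x r r\<^sub>0 C k a :: real
  assumes x: "x \<in> {0<..<1}" and a: "\<bar>a\<bar> \<le> k"
    and r: "\<bar>r\<bar> \<le> r\<^sub>0 * x" "\<bar>r\<bar> \<le> r\<^sub>0 * (1 - x)" "\<bar>r\<bar> \<le> C * x\<^sup>2"
    and C: "0 < C" and r0: "exp k * r\<^sub>0 \<le> 1 / 2"
    and x': "x' = exp a * x / (1 + (exp a - 1) * x) + r"
  shows "x' \<in> {0<..<1}"
    and "\<bar>logit x' - logit x - a\<bar> \<le> 4 * exp k * min r\<^sub>0 (C * exp (logit x))"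
proof -
  define d where "d = 1 + (exp a - 1) * x"
  have deq: "d = (1 - x) + exp a * x" by (simp add: d_def algebra_simps)
  have d: "d > 0" unfolding deq using x by (intro add_pos_pos mult_pos_pos) auto
  define y where "y = exp a * x / d"
  have y1: "1 - y = (1 - x) / d" using d by (simp add: y_def deq field_simps)
  have k: "0 \<le> k" using a by linarith
  have ek: "1 \<le> exp k" "exp a \<le> exp k" using a k by auto
  have d_le: "d \<le> exp k"
  proof -
    have "(1 - x) * 1 + exp a * x \<le> (1 - x) * exp k + exp k * x"
      using x ek by (intro add_mono mult_left_mono mult_right_mono) auto
    then show ?thesis by (simp add: deq algebra_simps)
  qed
  have d_le': "d \<le> exp k * exp a"
  proof -
    have "1 \<le> exp k * exp a" using a by (simp add: exp_add[symmetric])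
    moreover have "exp a \<le> exp k * exp a" using ek by simp
    ultimately have "(1 - x) * 1 + exp a * x \<le> (1 - x) * (exp k * exp a) + exp k * exp a * x"
      using x by (intro add_mono mult_left_mono mult_right_mono) auto
    then show ?thesis by (simp add: deq algebra_simps)
  qed
  have y_pos: "0 < y" "0 < 1 - y" using d x y1 by (auto simp: y_def)
  \<comment> \<open>The unperturbed map shrinks the distance to either end by at most the factor
    \<open>exp k\<close>, so bounds on \<open>r\<close> relative to \<open>x\<close> and
    \<open>1 - x\<close> carry over to \<open>y\<close> and \<open>1 - y\<close>.\<close>
  have inv: "x \<le> exp k * y" "1 - x \<le> exp k * (1 - y)"
  proof -
    have "x * d \<le> x * (exp k * exp a)" using d_le' x by (intro mult_left_mono) auto
    then show "x \<le> exp k * y" using d by (simp add: y_def field_simps)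
    have "(1 - x) * d \<le> (1 - x) * exp k" using d_le x by (intro mult_left_mono) auto
    then show "1 - x \<le> exp k * (1 - y)" using d by (simp add: y1 field_simps)
  qed
  define o' where "o' = x / (1 - x)"
  have "x * (1 - x) \<le> x * 1" using x by (intro mult_left_mono) auto
  then have o1: "x \<le> o'" using x by (simp add: o'_def pos_le_divide_eq)
  have "x * x \<le> x * 1" using x by (intro mult_left_mono) auto
  then have o2: "x\<^sup>2 / (1 - x) \<le> o'"
    using x unfolding o'_def power2_eq_square by (intro divide_right_mono) auto
  define M where "M = exp k * min r\<^sub>0 (C * o')"
  have p: "\<bar>r / y\<bar> \<le> M"
  proof -
    have "\<bar>r\<bar> \<le> x * min r\<^sub>0 (C * o')"
    proof -
      have "C * x\<^sup>2 \<le> x * (C * o')" using o1 C x by (simp add: power2_eq_square mult.left_commute mult_left_mono)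
      with r show ?thesis using x by (simp add: min_def mult.commute)
    qed
    also have "\<dots> \<le> exp k * y * min r\<^sub>0 (C * o')"
    proof (intro mult_right_mono inv)
      have "0 \<le> r\<^sub>0 * x" using r(1) by linarith
      then show "0 \<le> min r\<^sub>0 (C * o')" using x C by (simp add: o'_def zero_le_mult_iff)
    qed
    finally show ?thesis using y_pos by (simp add: M_def field_simps)
  qed
  have q: "\<bar>r / (1 - y)\<bar> \<le> M"
  proof -
    have "\<bar>r\<bar> \<le> (1 - x) * min r\<^sub>0 (C * o')"
    proof -
      have "C * x\<^sup>2 \<le> (1 - x) * (C * o')"
        using mult_left_mono[of "x\<^sup>2" "(1 - x) * o'" C] o2 C x
        by (simp add: pos_divide_le_eq mult_ac)
      with r show ?thesis using x by (simp add: min_def mult.commute)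
    qed
    also have "\<dots> \<le> exp k * (1 - y) * min r\<^sub>0 (C * o')"
    proof (intro mult_right_mono inv)
      have "0 \<le> r\<^sub>0 * x" using r(1) by linarith
      then show "0 \<le> min r\<^sub>0 (C * o')" using x C by (simp add: o'_def zero_le_mult_iff)
    qed
    finally show ?thesis using y_pos by (simp add: M_def field_simps)
  qed
  \<comment> \<open>Each of the two logarithms below is then at most \<open>2 * M\<close>, whence
    the factor 4 in the conclusion.\<close>
  have M: "M \<le> 1 / 2"
    unfolding M_def using r0 by (intro order_trans[OF mult_left_mono[of _ r\<^sub>0] r0]) auto
  have x'_eq: "x' = y + r" by (simp add: x' y_def d_def)
  have x'1: "x' = y * (1 + r / y)" using y_pos by (simp add: x'_eq field_simps)
  have x'2: "1 - x' = (1 - y) * (1 + - r / (1 - y))"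
    using y_pos by (simp add: x'_eq field_simps)
  have p1: "0 < 1 + r / y" using p M by linarith
  have q1: "0 < 1 + - r / (1 - y)" using abs_ge_self[of "r / (1 - y)"] q M by simp
  have "0 < x'" unfolding x'1 using y_pos p1 by (intro mult_pos_pos)
  moreover have "0 < 1 - x'" unfolding x'2 using y_pos q1 by (intro mult_pos_pos)
  ultimately show in01: "x' \<in> {0<..<1}" by simp
  have "logit x' = ln y + ln (1 + r / y) - (ln (1 - y) + ln (1 + - r / (1 - y)))"
    unfolding logit_eq[OF in01] unfolding x'1[symmetric] x'2[symmetric]
    using y_pos p1 q1 ln_mult_pos[of y "1 + r / y"] ln_mult_pos[of "1 - y" "1 + - r / (1 - y)"]
    by (simp only: x'1[symmetric] x'2[symmetric])
  moreover have "ln y = a + ln x - ln d" using d x by (simp add: y_def ln_div ln_mult)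
  moreover have "ln (1 - y) = ln (1 - x) - ln d" using d x by (simp add: y1 ln_div)
  ultimately have "logit x' - logit x - a = ln (1 + r / y) - ln (1 + - r / (1 - y))"
    using logit_eq[OF x] by simp
  moreover have "\<bar>ln (1 + r / y)\<bar> \<le> 2 * M"
    using abs_ln_one_plus_le[of "r / y"] p M by linarith
  moreover have "\<bar>ln (1 + - r / (1 - y))\<bar> \<le> 2 * M"
  proof -
    have "\<bar>- r / (1 - y)\<bar> \<le> M" using q by simp
    with abs_ln_one_plus_le[of "- r / (1 - y)"] M show ?thesis by linarith
  qed
  ultimately show "\<bar>logit x' - logit x - a\<bar> \<le> 4 * exp k * min r\<^sub>0 (C * exp (logit x))"
    using exp_logit[OF x] by (simp add: M_def o'_def)
qed

section \<open>Comparison of orbits with the killed walks\<close>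

lemma fibre_iter_add:
  "fibre_iter G (N + n) y x = fibre_iter G n ((doubling ^^ N) y) (fibre_iter G N y x)"
  by (induction n) (simp_all add: funpow_add_apply)

lemma passage_time_infinite:
  assumes "\<not> passage_time G x p y < \<infinity>" "0 < n"
  shows "fibre_iter G n y x \<le> p"
proof (rule ccontr)
  assume "\<not> fibre_iter G n y x \<le> p"
  with \<open>0 < n\<close> have "\<exists>n>0. fibre_iter G n y x > p" by auto
  with assms(1) show False by (simp add: passage_time_def)
qed

lemma passage_time_greater:
  assumes "\<And>j. 0 < j \<Longrightarrow> j \<le> n \<Longrightarrow> fibre_iter G j y x \<le> p"
  shows "enat n < passage_time G x p y"
proof (cases "\<exists>n>0. fibre_iter G n y x > p")
  case True
  define t where "t = (LEAST n. n > 0 \<and> fibre_iter G n y x > p)"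
  have "t > 0 \<and> fibre_iter G t y x > p" unfolding t_def by (rule LeastI_ex[OF True])
  with assms[of t] have "n < t" by force
  then show ?thesis using True by (simp add: passage_time_def t_def)
next
  case False
  then have "passage_time G x p y = \<infinity>" unfolding passage_time_def by (rule if_not_P)
  then show ?thesis by simp
qed

text \<open>The conditions \<open>small\<close> bound the drift: by 1, for monotone steps and the
  walk estimates; by \<open>\<delta> / 4\<close>, so that the descent along a repeated digit
  survives; and below the growth \<open>cosh \<delta>\<close> in the supermartingale.\<close>

locale logit_walk = mean_zero_base +
  fixes G :: "real \<times> real \<Rightarrow> real \<times> real" and r\<^sub>0 C :: real
  assumes r0_pos: "0 < r\<^sub>0" and C_pos: "0 < C"
    and small: "4 * exp k * r\<^sub>0 \<le> 1" "4 * exp k * r\<^sub>0 \<le> \<delta> / 4" "exp (4 * exp k * r\<^sub>0) < cosh \<delta>"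
    and fibre_in: "\<And>y x. y \<in> {0..<1} \<Longrightarrow> x \<in> {0<..<1} \<Longrightarrow> fibre_map G y x \<in> {0<..<1}"
    and fibre_logit: "\<And>y x. y \<in> {0..<1} \<Longrightarrow> x \<in> {0<..<1} \<Longrightarrow>
      \<bar>logit (fibre_map G y x) - logit x - \<xi> y\<bar> \<le> 4 * exp k * min r\<^sub>0 (C * exp (logit x))"
begin

definition drift :: "real \<Rightarrow> real" where
  "drift w = 4 * exp k * min r\<^sub>0 (C * exp w)"

lemma drift_nonneg: "0 \<le> drift w"
  using r0_pos C_pos by (simp add: drift_def)

lemma drift_le: "drift w \<le> 4 * exp k * r\<^sub>0"
  by (simp add: drift_def)

lemma drift_le_exp: "drift (w + L) \<le> 4 * exp k * C * exp L * exp w"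
proof -
  have "drift (w + L) \<le> 4 * exp k * (C * exp (w + L))"
    unfolding drift_def by (intro mult_left_mono) auto
  then show ?thesis by (simp add: exp_add mult_ac)
qed

lemma drift_mono: "w \<le> w' \<Longrightarrow> drift w \<le> drift w'"
  unfolding drift_def using C_pos by (intro mult_left_mono min.mono) auto

text \<open>This is where \<open>4 * exp k * r\<^sub>0 \<le> 1\<close> is needed: the worst-case downward step is monotone.\<close>

lemma drift_nonexpansive:
  assumes "w \<le> w'" shows "w - drift w \<le> w' - drift w'"
proof (cases "r\<^sub>0 \<le> C * exp w")
  case True
  then have "drift w = 4 * exp k * r\<^sub>0" by (simp add: drift_def)
  with drift_le[of w'] assms show ?thesis by linarith
next
  case False
  then have w: "drift w = 4 * exp k * C * exp w" by (simp add: drift_def)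
  \<comment> \<open>Here \<open>drift w' \<le> drift w * exp (w' - w)\<close>; with
    \<open>1 + t \<le> exp t\<close> and \<open>drift w' \<le> 1\<close> the drift grows no faster
    than its argument.\<close>
  have "drift w' \<le> 4 * exp k * (C * exp w')" unfolding drift_def by (intro mult_left_mono) auto
  also have "\<dots> = drift w * exp (w' - w)" by (simp add: w exp_diff)
  finally have "drift w' * exp (w - w') \<le> drift w * exp (w' - w) * exp (w - w')"
    by (intro mult_right_mono) auto
  also have "\<dots> = drift w" by (simp add: mult.assoc exp_add[symmetric])
  finally have "drift w' * exp (w - w') \<le> drift w" .
  moreover have "drift w' * (1 + (w - w')) \<le> drift w' * exp (w - w')"
    by (intro mult_left_mono exp_ge_add_one_self drift_nonneg)
  moreover have "drift w' * (w' - w) \<le> 1 * (w' - w)"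
    using assms drift_le[of w'] small by (intro mult_right_mono) auto
  ultimately show ?thesis by (simp add: algebra_simps)
qed

lemma fibre_iter_in:
  "y \<in> {0..<1} \<Longrightarrow> x \<in> {0<..<1} \<Longrightarrow> fibre_iter G n y x \<in> {0<..<1}"
proof (induction n)
  case (Suc n)
  then show ?case
    using fibre_in[OF doubling_funpow_in[OF Suc.prems(1), of n] Suc.IH[OF Suc.prems]] by simp
qed simp

lemma fibre_iter_logit:
  assumes "y \<in> {0..<1}" "x \<in> {0<..<1}"
  shows "\<bar>logit (fibre_iter G (Suc n) y x) - logit (fibre_iter G n y x) - \<xi> ((doubling ^^ n) y)\<bar>
    \<le> drift (logit (fibre_iter G n y x))"
  using fibre_logit[OF doubling_funpow_in[OF assms(1)] fibre_iter_in[OF assms]] by (simp add: drift_def)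

text \<open>The martingale with worst-case drift, downward for \<open>s = - 1\<close> and upward for
  \<open>s = 1\<close>. The orbit differs from it by a distortion of at most \<open>L\<close>;
  evaluating the drift at the shift by \<open>L\<close> makes the process depend on the word
  alone.\<close>

primrec comparison :: "real \<Rightarrow> real \<Rightarrow> bool list \<Rightarrow> real" where
  "comparison s w [] = w"
| "comparison s w (b # u) = comparison s w u + (mean_sum \<xi> (b # u) - mean_sum \<xi> u) +
     s * drift (comparison s w u + L)"

lemma comparison_True:
  "comparison s w (True # u) = comparison s w u + s * drift (comparison s w u + L) + increment u"
  by (simp add: mean_sum_True)

lemma comparison_False:
  "comparison s w (False # u) = comparison s w u + s * drift (comparison s w u + L) - increment u"
  by (simp add: mean_sum_False)

text \<open>Keeping the exact distortion term in the claim lets the induction reproduce it.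
  Monotonicity of \<open>w - drift w\<close> transfers the bound through a step, and
  \<open>drift\<close> at the true lower bound is at most \<open>drift\<close> at the shift by
  \<open>L\<close>.\<close>

lemma comparison_lower:
  assumes y: "y \<in> {0..<1}" and x: "x \<in> {0<..<1}"
  shows "comparison (- 1) (logit x) (digits n y) + birkhoff_at \<xi> n y - mean_sum \<xi> (digits n y)
    \<le> logit (fibre_iter G n y x)"
proof (induction n)
  case (Suc n)
  define w where "w = comparison (- 1) (logit x) (digits n y)"
  define w' where "w' = w + birkhoff_at \<xi> n y - mean_sum \<xi> (digits n y)"
  have IH: "w' \<le> logit (fibre_iter G n y x)" using Suc by (simp add: w'_def w_def)
  have "drift w' \<le> drift (w + L)"
    using birkhoff_at_near_mean[OF y, of n] by (intro drift_mono) (simp add: w'_def)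
  with drift_nonexpansive[OF IH] fibre_iter_logit[OF y x, of n] show ?case
    by (simp add: birkhoff_at_Suc[OF y] w_def[symmetric] w'_def del: fibre_iter.simps)
qed simp

text \<open>As for the lower bound, with monotonicity of \<open>drift\<close> itself. The start
  \<open>w\<^sub>0\<close> is free so that one walk started at \<open>- R\<close> bounds all orbits
  starting lower.\<close>

lemma comparison_upper:
  assumes y: "y \<in> {0..<1}" and x: "x \<in> {0<..<1}" and w0: "logit x \<le> w\<^sub>0"
  shows "logit (fibre_iter G n y x) \<le>
    comparison 1 w\<^sub>0 (digits n y) + birkhoff_at \<xi> n y - mean_sum \<xi> (digits n y)"
proof (induction n)
  case (Suc n)
  define w where "w = comparison 1 w\<^sub>0 (digits n y)"
  define w' where "w' = w + birkhoff_at \<xi> n y - mean_sum \<xi> (digits n y)"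
  have IH: "logit (fibre_iter G n y x) \<le> w'" using Suc by (simp add: w'_def w_def)
  have "drift w' \<le> drift (w + L)"
    using birkhoff_at_near_mean[OF y, of n] by (intro drift_mono) (simp add: w'_def)
  with drift_mono[OF IH] IH fibre_iter_logit[OF y x, of n] show ?case
    by (simp add: birkhoff_at_Suc[OF y] w_def[symmetric] w'_def del: fibre_iter.simps)
qed (use w0 in simp)

text \<open>An orbit that never passes \<open>p\<close> keeps the lower walk below
  \<open>logit p + L\<close> forever, an event of measure at most every
  \<open>survival v H n\<close>.\<close>

lemma passage_time_finite:
  assumes x: "x \<in> {0<..<1}" and p: "p \<in> {0<..<1}" and "x < p"
  shows "AE y in lebesgue_on {0..1}. passage_time G x p y < \<infinity>"
proof -
  define v where "v = comparison (- 1) (logit x)"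
  define H where "H = logit p + L"
  define E where "E n = {y \<in> {0..<1}. stays_below v H (digits n y)}" for n
  have "survival v H \<longlonglongrightarrow> 0"
  proof (rule survival_tendsto_0[where c = "\<lambda>u. drift (v u + L)" and t = increment and \<delta> = \<delta>
        and D = "L + k" and q = "4 * exp k * r\<^sub>0" and A = "4 * exp k * C * exp L"])
    show "v (True # u) = v u - drift (v u + L) + increment u"
      "v (False # u) = v u - drift (v u + L) - increment u" for u
      unfolding v_def comparison_True comparison_False by simp_all
    show "0 < 4 * exp k * C * exp L" using C_pos by simp
    show "exp (4 * exp k * r\<^sub>0) < cosh \<delta>" by (rule small)
    show "4 * exp k * r\<^sub>0 \<le> 1" by (rule small)
  qed (rule increment_lower increment_upper drift_nonneg drift_le drift_le_exp delta_pos)+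
  then have "(\<lambda>n. ennreal (survival v H n)) \<longlonglongrightarrow> 0"
    using tendsto_ennrealI[of "survival v H" 0] by simp
  moreover have E: "E n \<in> sets lebesgue" "emeasure lebesgue (E n) = ennreal (survival v H n)" for n
    unfolding E_def survival_def by (rule sets_cylinders, rule emeasure_cylinders)
  moreover have "emeasure lebesgue (\<Inter>n. E n) \<le> ennreal (survival v H n)" for n
    unfolding E(2)[symmetric] by (intro emeasure_mono) (use E in auto)
  ultimately have "emeasure lebesgue (\<Inter>n. E n) = 0"
    using LIMSEQ_le_const[of _ 0 "emeasure lebesgue (\<Inter>n. E n)"] by auto
  \<comment> \<open>The point 1, outside the digit coding, joins the exceptional set.\<close>
  then have null: "(\<Inter>n. E n) \<union> {1} \<in> null_sets lebesgue"
    using E(1) by (intro null_sets.Un) (auto simp: null_sets_def)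
  have "passage_time G x p y < \<infinity>" if y: "y \<in> {0..1}" "y \<notin> (\<Inter>n. E n) \<union> {1}" for y
  proof (rule ccontr)
    assume inf: "\<not> passage_time G x p y < \<infinity>"
    have y': "y \<in> {0..<1}" using y by auto
    \<comment> \<open>Passage times count only \<open>n > 0\<close>; time 0 is covered by
      \<open>x < p\<close>.\<close>
    have le: "logit (fibre_iter G n y x) \<le> logit p" for n
    proof (cases "n = 0")
      case True
      then show ?thesis using x p \<open>x < p\<close> logit_less_iff[OF x p] by simp
    next
      case False
      then have "fibre_iter G n y x \<le> p" using passage_time_infinite[OF inf] by simp
      then show ?thesis using logit_less_iff[OF p fibre_iter_in[OF y' x, of n]] by simp
    qed
    have "v (digits n y) \<le> H" for n
      using comparison_lower[OF y' x, of n] birkhoff_at_near_mean[OF y', of n] le[of n]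
      by (simp add: v_def H_def abs_le_iff)
    have "stays_below v H (digits n y)" for n
    proof (induction n)
      case 0 show ?case using \<open>\<And>n. v (digits n y) \<le> H\<close>[of 0] by simp
    next
      case (Suc n) then show ?case using \<open>\<And>n. v (digits n y) \<le> H\<close>[of "Suc n"] by simp
    qed
    then show False using y y' by (auto simp: E_def)
  qed
  with null show ?thesis
    by (subst AE_restrict_space_iff) (auto intro!: AE_I'[OF null])
qed

text \<open>Near the fixed point a step moves the logit by at most \<open>- \<delta>\<close>, plus a
  Lipschitz error and a drift of at most \<open>\<delta> / 4\<close>. The bound is kept for all
  \<open>i \<le> N\<close> because the orbit must not pass \<open>p\<close> on the way down.\<close>

lemma prefix_descent:
  assumes b: "\<xi> (of_bool b) \<le> - \<delta>" and y: "y \<in> {0..<1}" and x: "x \<in> {0<..<1}"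
    and dig: "digits N y = replicate N b" and N: "4 * L \<le> real N * \<delta>" "0 < N" and i: "i \<le> N"
  shows "logit (fibre_iter G i y x) \<le> logit x - real i * (\<delta> / 2)"
proof -
  \<comment> \<open>The Lipschitz errors grow geometrically, so a term that doubles at each step
    absorbs their sum.\<close>
  have "logit (fibre_iter G i y x) \<le> logit x - real i * (3 * \<delta> / 4) + L * (2 ^ i / 2 ^ N)"
    using i
  proof (induction i)
    case 0 then show ?case using L_nonneg by simp
  next
    case (Suc i)
    let ?t = "(doubling ^^ i) y"
    have "\<xi> ?t \<le> \<xi> (of_bool b) + L * \<bar>?t - of_bool b\<bar>"
      using lip[of ?t "of_bool b"] doubling_funpow_in[OF y, of i] by (cases b) auto
    also have "\<dots> \<le> - \<delta> + L * (2 ^ i / 2 ^ N)"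
      using b dist_fixed_point[OF y dig, of i] Suc.prems L_nonneg
      by (intro add_mono mult_left_mono) auto
    finally have "\<xi> ?t \<le> - \<delta> + L * (2 ^ i / 2 ^ N)" .
    moreover have "logit (fibre_iter G (Suc i) y x) \<le> logit (fibre_iter G i y x) + \<xi> ?t + \<delta> / 4"
      using fibre_iter_logit[OF y x, of i] drift_le[of "logit (fibre_iter G i y x)"] small(2)
      by linarith
    moreover have "L * (2 ^ Suc i / 2 ^ N) = 2 * (L * (2 ^ i / 2 ^ N))" by simp
    moreover have "real (Suc i) * (3 * \<delta> / 4) = real i * (3 * \<delta> / 4) + 3 * \<delta> / 4"
      by (simp add: algebra_simps)
    ultimately show ?case using Suc by linarith
  qed
  \<comment> \<open>With \<open>N = i + j\<close> the error is \<open>L / 2 ^ j\<close>, and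
    \<open>N \<le> i * Suc j \<le> i * 2 ^ j\<close> turns
    \<open>4 * L \<le> real N * \<delta>\<close> into the claim. At \<open>i = 0\<close> it may
    fail, so that case is separate.\<close>
  moreover have "L * (2 ^ i / 2 ^ N) \<le> real i * (\<delta> / 4)" if "0 < i"
  proof -
    obtain j where j: "N = i + j" using i le_Suc_ex by blast
    have "N \<le> i * Suc j" using that by (simp add: j)
    also have "\<dots> \<le> i * 2 ^ j" by (intro mult_left_mono) (simp_all add: Suc_le_eq)
    finally have "real N \<le> real i * 2 ^ j" by (metis of_nat_le_iff of_nat_mult of_nat_numeral of_nat_power)
    then have "real N * \<delta> \<le> real i * 2 ^ j * \<delta>" using delta_pos by (intro mult_right_mono) auto
    with N have "4 * L \<le> real i * 2 ^ j * \<delta>" by linarith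
    then show ?thesis by (simp add: j power_add field_simps)
  qed
  moreover have "logit (fibre_iter G 0 y x) = logit x" by simp
  moreover have "real i * (3 * \<delta> / 4) = real i * (\<delta> / 4) + real i * (\<delta> / 2)" by (simp add: field_simps)
  ultimately show ?thesis
    by (cases "i = 0") (simp, linarith)
qed

text \<open>After \<open>N\<close> copies of the descending digit the orbit lies below
  \<open>- R\<close>, and the upper walk then survives \<open>n\<close> steps with probability at
  least \<open>1 / (a + D * real n)\<close>. Thus the tails of the passage time dominate a harmonic
  series.\<close>

lemma passage_time_not_integrable:
  assumes x: "x \<in> {0<..<1}" and p: "p \<in> {0<..<1}" and "x < p"
  shows "(\<integral>\<^sup>+ y. ennreal_of_enat (passage_time G x p y) \<partial>lebesgue_on {0..1}) = \<infinity>"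
proof (rule ccontr)
  let ?T = "passage_time G x p"
  assume "(\<integral>\<^sup>+ y. ennreal_of_enat (?T y) \<partial>lebesgue_on {0..1}) \<noteq> \<infinity>"
  then obtain I where I: "0 \<le> I" "(\<integral>\<^sup>+ y. ennreal_of_enat (?T y) \<partial>lebesgue_on {0..1}) = ennreal I"
    by (metis ennreal_cases infinity_ennreal_def)
  define D where "D = L + k"
  have D: "0 < D" using increment_lower[of "[]"] increment_upper[of "[]"] delta_pos by (simp add: D_def)
  \<comment> \<open>Survival below \<open>H\<close> leaves room for the distortion \<open>L\<close>
    and still keeps the orbit at most \<open>p\<close>.\<close>
  define H where "H = logit p - L"
  have A: "0 < 4 * exp k * C * exp L" using C_pos by simp
  obtain R a where a: "0 < a"
    and surv: "\<And>v c t n. v [] = - R \<Longrightarrow> (\<And>u. v (True # u) = v u + c u + t u) \<Longrightarrow>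
      (\<And>u. v (False # u) = v u + c u - t u) \<Longrightarrow> (\<And>u. \<delta> \<le> \<bar>t u\<bar>) \<Longrightarrow> (\<And>u. \<bar>t u\<bar> \<le> D) \<Longrightarrow>
      (\<And>u. 0 \<le> c u) \<Longrightarrow> (\<And>u. c u \<le> 1) \<Longrightarrow> (\<And>u. c u \<le> 4 * exp k * C * exp L * exp (v u)) \<Longrightarrow>
      1 / (a + D * real n) \<le> survival v H n"
    using survival_lower_bound[OF delta_pos D A] by metis
  define v where "v = comparison 1 (- R)"
  have survive: "1 / (a + D * real n) \<le> survival v H n" for n
  proof (rule surv[where c = "\<lambda>u. drift (v u + L)" and t = increment])
    show "v [] = - R" by (simp add: v_def)
    show "v (True # u) = v u + drift (v u + L) + increment u"
      "v (False # u) = v u + drift (v u + L) - increment u" for u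
      unfolding v_def comparison_True comparison_False by simp_all
    show "drift (v u + L) \<le> 1" for u using drift_le[of "v u + L"] small(1) by linarith
  qed ((unfold D_def)?, rule increment_lower increment_upper drift_nonneg drift_le_exp)+
  obtain b where b: "\<xi> (of_bool b) \<le> - \<delta>" using exists_descending_digit by blast
  \<comment> \<open>Large enough to be positive, to absorb the Lipschitz error, and to descend from
    \<open>logit x\<close> to \<open>- R\<close>.\<close>
  obtain N :: nat where N: "max 1 (max (4 * L / \<delta>) ((logit x + R) / (\<delta> / 2))) \<le> real N"
    using real_arch_simple by blast
  then have N1: "0 < N" "4 * L \<le> real N * \<delta>" "logit x + R \<le> real N * (\<delta> / 2)"
    using delta_pos by (auto simp: pos_divide_le_eq field_simps)
  define B where "B n = {y \<in> {0..<1}. digits N y = replicate N b \<and>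
      stays_below v H (digits n ((doubling ^^ N) y))}" for n
  \<comment> \<open>Words list the newest digit first, so the initial block of \<open>N\<close>
    digits is what remains after dropping \<open>n\<close>.\<close>
  define P where "P n w \<longleftrightarrow> drop n w = replicate N b \<and> stays_below v H (take n w)" for n and w :: "bool list"
  have B: "B n = {y \<in> {0..<1}. P n (digits (N + n) y)}" for n
    by (auto simp: B_def P_def digits_add)
  have B_sets: "B n \<in> sets lebesgue" for n unfolding B by (rule sets_cylinders)
  have B_measure: "ennreal (1 / (a + D * real n) / 2 ^ N) \<le> emeasure lebesgue (B n)" for n
  proof -
    have "(\<Sum>u\<in>words n. of_bool (stays_below v H u)) =
        (\<Sum>w\<in>(\<lambda>u. u @ replicate N b) ` words n. of_bool (P n w) :: real)"
      by (subst sum.reindex) (auto simp: inj_on_def P_def length_words intro!: sum.cong)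
    also have "\<dots> \<le> (\<Sum>w\<in>words (N + n). of_bool (P n w))"
      by (intro sum_mono2 finite_words) (auto simp: words_def)
    finally have "survival v H n / 2 ^ N \<le> (\<Sum>w\<in>words (N + n). of_bool (P n w)) / 2 ^ (N + n)"
      unfolding survival_def by (simp add: power_add field_simps)
    with divide_right_mono[OF survive[of n], of "2 ^ N"]
    have "1 / (a + D * real n) / 2 ^ N \<le> (\<Sum>w\<in>words (N + n). of_bool (P n w)) / 2 ^ (N + n)"
      by simp
    then show ?thesis unfolding B emeasure_cylinders by (rule ennreal_leI)
  qed
  have late: "enat n < ?T y" if "y \<in> B n" for n y
  proof -
    have y: "y \<in> {0..<1}" and dig: "digits N y = replicate N b"
      and stay: "stays_below v H (digits n ((doubling ^^ N) y))" using that by (auto simp: B_def)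
    let ?y = "(doubling ^^ N) y" and ?x = "fibre_iter G N y x"
    have y': "?y \<in> {0..<1}" using y by (rule doubling_funpow_in)
    have x': "?x \<in> {0<..<1}" using y x by (rule fibre_iter_in)
    have start: "logit ?x \<le> - R"
      using prefix_descent[OF b y x dig N1(2,1) order_refl] N1(3) by linarith
    have le: "logit (fibre_iter G j y x) \<le> logit p" if "j \<le> N + n" for j
    proof (cases "j \<le> N")
      case True
      have "logit (fibre_iter G j y x) \<le> logit x - real j * (\<delta> / 2)"
        by (rule prefix_descent[OF b y x dig N1(2,1) True])
      also have "\<dots> \<le> logit x" using delta_pos by simp
      also have "\<dots> \<le> logit p" using logit_less_iff[OF x p] \<open>x < p\<close> by simp
      finally show ?thesis .
    next
      case False
      then obtain i where i: "j = N + i" using le_Suc_ex[of N j] by auto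
      with that stay have "stays_below v H (digits i ?y)" by (intro stays_below_digits[of i n]) auto
      then have "v (digits i ?y) \<le> H" by (rule stays_below_le)
      then show ?thesis
        using comparison_upper[OF y' x' start, of i] birkhoff_at_near_mean[OF y', of i]
        by (simp add: i fibre_iter_add v_def H_def abs_le_iff)
    qed
    have "enat (N + n) < ?T y"
    proof (rule passage_time_greater)
      fix j assume "j \<le> N + n"
      then show "fibre_iter G j y x \<le> p"
        using le[of j] logit_less_iff[OF p fibre_iter_in[OF y x, of j]] by simp
    qed
    then show ?thesis by (rule le_less_trans[rotated]) simp
  qed
  \<comment> \<open>Tail-sum formula: the integral of the passage time is at least the sum of the
    measures of \<open>B n\<close>, since each such set lies in
    \<open>enat n < ?T y\<close>.\<close>
  have partial: "(\<Sum>n<K. 1 / (a + D * real n) / 2 ^ N) \<le> I" for K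
  proof -
    have sub: "B n \<subseteq> {0..1}" for n by (auto simp: B_def)
    have sets': "B n \<in> sets (lebesgue_on {0..1})" for n
      using B_sets sub by (simp add: sets_restrict_space_iff)
    have "ennreal (\<Sum>n<K. 1 / (a + D * real n) / 2 ^ N) = (\<Sum>n<K. ennreal (1 / (a + D * real n) / 2 ^ N))"
      using a D by (intro sum_ennreal[symmetric]) auto
    also have "\<dots> \<le> (\<Sum>n<K. emeasure lebesgue (B n))" by (intro sum_mono B_measure)
    also have "\<dots> = (\<Sum>n<K. emeasure (lebesgue_on {0..1}) (B n))"
      using sub by (simp add: emeasure_restrict_space)
    also have "\<dots> = (\<integral>\<^sup>+ y. (\<Sum>n<K. indicator (B n) y) \<partial>lebesgue_on {0..1})"
      using sets' by (simp add: nn_integral_sum)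
    also have "\<dots> \<le> (\<integral>\<^sup>+ y. ennreal_of_enat (?T y) \<partial>lebesgue_on {0..1})"
    proof (rule nn_integral_mono)
      fix y
      show "(\<Sum>n<K. indicator (B n) y) \<le> ennreal_of_enat (?T y)"
      proof (cases "?T y")
        case (enat t)
        have "(\<Sum>n<K. indicator (B n) y) \<le> (\<Sum>n<K. of_bool (n < t) :: ennreal)"
          using late[of y] enat by (intro sum_mono) (auto simp: indicator_def)
        also have "\<dots> = of_nat (card ({..<K} \<inter> {..<t}))" by (simp add: Int_def lessThan_def)
        also have "\<dots> \<le> of_nat t" using card_mono[of "{..<t}" "{..<K} \<inter> {..<t}"] by simp
        finally show ?thesis using enat by (simp add: ennreal_of_enat_def)
      qed simp
    qed
    also have "\<dots> = ennreal I" by (rule I)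
    finally show ?thesis using I by simp
  qed
  have "summable (\<lambda>n. 1 / (a + D * real n) / 2 ^ N)"
    using a D partial by (intro summableI_nonneg_bounded[of _ I]) auto
  then have "summable (\<lambda>n. (2 ^ N * (a + D)) * (1 / (a + D * real n) / 2 ^ N))"
    by (rule summable_mult)
  then have "summable (\<lambda>n. inverse (real (Suc n)))"
  proof (rule summable_comparison_test'[where N = 0])
    fix n
    have "a + D * real n \<le> (a + D) * real (Suc n)" using a D by (simp add: algebra_simps)
    then show "norm (inverse (real (Suc n))) \<le> 2 ^ N * (a + D) * (1 / (a + D * real n) / 2 ^ N)"
      using a D by (simp add: field_simps add_pos_nonneg)
  qed
  then show False using not_summable_harmonic summable_Suc_iff by blast
qed

end

section \<open>Smooth skew products\<close>

lemma smooth_onE: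
  assumes "smooth_on S f"
  obtains U F where "open U" "S \<subseteq> U" "\<And>x. x \<in> S \<Longrightarrow> F x = f x"
    "\<And>x. x \<in> U \<Longrightarrow> F differentiable (at x)"
    "\<And>v. continuous_on U (\<lambda>x. frechet_derivative F (at x) v)"
proof -
  obtain U F where UF: "open U" "S \<subseteq> U" "\<And>x. x \<in> S \<Longrightarrow> F x = f x"
    and hd: "\<And>k. higher_differentiable_on U F k"
    using assms unfolding smooth_on_def by blast
  from hd[of "Suc 0"] have "\<And>x. x \<in> U \<Longrightarrow> F differentiable (at x)"
    "\<And>v. continuous_on U (\<lambda>x. frechet_derivative F (at x) v)" by auto
  with UF show ?thesis by (rule that)
qed

lemma smooth_on_interval_lipschitz:
  fixes f :: "real \<Rightarrow> real"
  assumes "smooth_on {0..1} f"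
  obtains L where "\<And>y z. y \<in> {0..1} \<Longrightarrow> z \<in> {0..1} \<Longrightarrow> \<bar>f y - f z\<bar> \<le> L * \<bar>y - z\<bar>"
proof -
  obtain U F where U: "{0..1} \<subseteq> U" "\<And>x. x \<in> {0..1} \<Longrightarrow> F x = f x"
    and diff: "\<And>x. x \<in> U \<Longrightarrow> F differentiable (at x)"
    and cont: "\<And>v. continuous_on U (\<lambda>x. frechet_derivative F (at x) v)"
    using smooth_onE[OF assms] by metis
  define F' where "F' x = frechet_derivative F (at x) 1" for x
  have "continuous_on {0..1} F'" unfolding F'_def using cont U(1) by (rule continuous_on_subset)
  then have "bounded (F' ` {0..1})" by (intro compact_imp_bounded compact_continuous_image) auto
  then obtain L where L: "\<And>x. x \<in> {0..1} \<Longrightarrow> \<bar>F' x\<bar> \<le> L" by (force simp: bounded_iff)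
  have der: "(F has_real_derivative F' x) (at x within {0..1})" if "x \<in> {0..1}" for x
  proof -
    have h: "(F has_derivative frechet_derivative F (at x)) (at x)"
      using diff that U(1) by (auto simp: frechet_derivative_works[symmetric])
    have "frechet_derivative F (at x) t = F' x * t" for t
      unfolding F'_def using linear_cmul[OF has_derivative_linear[OF h], of t 1] by simp
    then have "frechet_derivative F (at x) = (*) (F' x)" by (rule ext)
    with h have "(F has_real_derivative F' x) (at x)"
      by (simp only: has_field_derivative_def)
    then show ?thesis by (rule has_field_derivative_at_within)
  qed
  show ?thesis
  proof (rule that[of L])
    fix y z :: real assume "y \<in> {0..1}" "z \<in> {0..1}"
    then have "norm (F y - F z) \<le> L * norm (y - z)"
      using L by (intro field_differentiable_bound[OF _ der]) auto
    then show "\<bar>f y - f z\<bar> \<le> L * \<bar>y - z\<bar>"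
      using U(2) \<open>y \<in> {0..1}\<close> \<open>z \<in> {0..1}\<close> by simp
  qed
qed

lemma smooth_on_interval_continuous:
  assumes "smooth_on S f" shows "continuous_on S f"
proof -
  obtain U F where U: "open U" "S \<subseteq> U" "\<And>x. x \<in> S \<Longrightarrow> F x = f x"
    and diff: "\<And>x. x \<in> U \<Longrightarrow> F differentiable (at x)"
    using smooth_onE[OF assms] by metis
  have "continuous_on S F"
    using diff U(2) by (intro continuous_at_imp_continuous_on) (auto intro: differentiable_imp_continuous_within)
  then show ?thesis using U(3) by (simp cong: continuous_on_cong)
qed

lemma logistic_denominator_pos:
  fixes a x :: real assumes "x \<in> {0..1}" shows "0 < 1 + (exp a - 1) * x"
proof -
  have "1 + (exp a - 1) * x = (1 - x) + exp a * x" by (simp add: algebra_simps)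
  moreover have "\<dots> > 0"
    using assms by (cases "x = 0") (auto intro!: add_nonneg_pos)
  ultimately show ?thesis by simp
qed

text \<open>The bound on \<open>vector_derivative\<close> is informative only where the derivative
  exists; smoothness of the fibre maps supplies this, and the mean value inequality then
  applies.\<close>

lemma remainder_lipschitz:
  assumes G: "G \<in> skew_maps \<xi> C r\<^sub>0" and y: "y \<in> {0..1}"
    and "x \<in> {0..1}" "z \<in> {0..1}"
  shows "\<bar>remainder \<xi> G y x - remainder \<xi> G y z\<bar> \<le> r\<^sub>0 * \<bar>x - z\<bar>"
proof -
  have "smooth_on ({0..1} \<times> {0..1}) (\<lambda>(y, x). fibre_map G y x)"
    using G by (simp add: skew_maps_def)
  then obtain U F where U: "{0..1} \<times> {0..1} \<subseteq> U"
      "\<And>w. w \<in> {0..1} \<times> {0..1} \<Longrightarrow> F w = (\<lambda>(y, x). fibre_map G y x) w"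
    and diff: "\<And>w. w \<in> U \<Longrightarrow> F differentiable (at w)"
    using smooth_onE by metis
  have "remainder \<xi> G y differentiable (at t within {0..1})" if t: "t \<in> {0..1}" for t
  proof -
    have "(\<lambda>s. F (y, s)) differentiable (at t within {0..1})"
    proof -
      obtain F' where "(F has_derivative F') (at (y, t))"
        using diff[of "(y, t)"] U(1) y t unfolding differentiable_def by blast
      then have "((\<lambda>s. F (y, s)) has_derivative (\<lambda>s. F' (0, s))) (at t within {0..1})"
        by (rule has_derivative_compose[OF has_derivative_Pair[OF has_derivative_const has_derivative_ident]])
      then show ?thesis by (rule differentiableI)
    qed
    moreover have "(\<lambda>s. exp (\<xi> y) * s / (1 + (exp (\<xi> y) - 1) * s)) differentiable (at t within {0..1})"
      using logistic_denominator_pos[OF t, of "\<xi> y"] by (intro derivative_intros) auto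
    ultimately have "(\<lambda>s. F (y, s) - exp (\<xi> y) * s / (1 + (exp (\<xi> y) - 1) * s)) differentiable (at t within {0..1})"
      by (rule differentiable_diff)
    then show ?thesis
      by (rule differentiable_transform_within[OF _ zero_less_one t]) (use U(2) y in \<open>auto simp: remainder_def\<close>)
  qed
  then have der: "(remainder \<xi> G y has_field_derivative
      vector_derivative (remainder \<xi> G y) (at t within {0..1})) (at t within {0..1})"
    if "t \<in> {0..1}" for t
    using that by (simp add: has_real_derivative_iff_has_vector_derivative vector_derivative_works[symmetric])
  have "norm (remainder \<xi> G y x - remainder \<xi> G y z) \<le> r\<^sub>0 * norm (x - z)"
    using G y assms(3,4) by (intro field_differentiable_bound[OF _ der]) (auto simp: skew_maps_def)
  then show ?thesis by simp
qed

text \<open>The bounds with \<open>C\<close> force the remainder to vanish at 0 and 1; its Lipschitz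
  constant \<open>r\<^sub>0\<close> then bounds it relative to the distance from either end.\<close>

lemma fibre_map_logit:
  assumes G: "G \<in> skew_maps \<xi> C r\<^sub>0" and y: "y \<in> {0..1}" and x: "x \<in> {0<..<1}"
    and k: "\<bar>\<xi> y\<bar> \<le> k" and C: "0 < C" and r0: "exp k * r\<^sub>0 \<le> 1 / 2"
  shows "fibre_map G y x \<in> {0<..<1}"
    and "\<bar>logit (fibre_map G y x) - logit x - \<xi> y\<bar> \<le> 4 * exp k * min r\<^sub>0 (C * exp (logit x))"
proof -
  let ?r = "remainder \<xi> G y"
  have bounds: "\<bar>?r t\<bar> \<le> C * t\<^sup>2" "\<bar>?r t\<bar> \<le> C * \<bar>1 - t\<bar>" if "t \<in> {0..1}" for t
    using G y that by (auto simp: skew_maps_def)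
  have "?r 0 = 0" "?r 1 = 0" using bounds(1)[of 0] bounds(2)[of 1] by auto
  then have r: "\<bar>?r x\<bar> \<le> r\<^sub>0 * x" "\<bar>?r x\<bar> \<le> r\<^sub>0 * (1 - x)"
    using remainder_lipschitz[OF G y, of x 0] remainder_lipschitz[OF G y, of x 1] x by auto
  have r': "\<bar>?r x\<bar> \<le> C * x\<^sup>2" using bounds(1)[of x] x by simp
  have eq: "fibre_map G y x = exp (\<xi> y) * x / (1 + (exp (\<xi> y) - 1) * x) + ?r x"
    by (simp add: remainder_def)
  show "fibre_map G y x \<in> {0<..<1}"
    "\<bar>logit (fibre_map G y x) - logit x - \<xi> y\<bar> \<le> 4 * exp k * min r\<^sub>0 (C * exp (logit x))"
    by (rule logit_perturbation[OF x k r r' C r0 eq])+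
qed

section \<open>Constants extracted from \<open>\<xi>\<close> and the range of
  \<open>r\<^sub>0\<close>\<close>

lemma mean_zero_base_exists:
  fixes \<xi> :: "real \<Rightarrow> real"
  assumes smooth: "smooth_on {0..1} \<xi>"
    and mono: "strict_mono_on {0..1} \<xi> \<or> strict_antimono_on {0..1} \<xi>"
    and mean: "integral {0..1} \<xi> = 0"
  obtains \<sigma> L k \<delta> where "mean_zero_base \<xi> \<sigma> L k \<delta>"
proof -
  obtain L where L: "\<And>y z. y \<in> {0..1} \<Longrightarrow> z \<in> {0..1} \<Longrightarrow> \<bar>\<xi> y - \<xi> z\<bar> \<le> L * \<bar>y - z\<bar>"
    using smooth_on_interval_lipschitz[OF smooth] by metis
  have cont: "continuous_on {0..1} \<xi>" by (rule smooth_on_interval_continuous[OF smooth])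
  then have "bounded (\<xi> ` {0..1})" by (intro compact_imp_bounded compact_continuous_image) auto
  then obtain k where k: "\<And>y. y \<in> {0..1} \<Longrightarrow> \<bar>\<xi> y\<bar> \<le> k" by (force simp: bounded_iff)
  obtain \<sigma> :: real where \<sigma>: "\<bar>\<sigma>\<bar> = 1"
    and smono: "\<And>y z. 0 \<le> y \<Longrightarrow> y < z \<Longrightarrow> z \<le> 1 \<Longrightarrow> \<sigma> * \<xi> y < \<sigma> * \<xi> z"
    using mono
  proof
    assume "strict_mono_on {0..1} \<xi>"
    then show thesis by (intro that[of 1]) (auto simp: strict_mono_on_def)
  next
    assume "strict_antimono_on {0..1} \<xi>"
    then show thesis by (intro that[of "- 1"]) (auto simp: monotone_on_def)
  qed
  \<comment> \<open>By compactness \<open>f\<close> attains its minimum, positive by strict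
    monotonicity; half of it serves as \<open>\<delta>\<close>.\<close>
  define f where "f z = \<sigma> * (\<xi> (half_branch True z) - \<xi> (half_branch False z))" for z
  have "continuous_on {0..1} (\<lambda>z. \<xi> (half_branch b z))" for b
    by (rule continuous_on_compose2[OF cont]) (auto simp: half_branch_def intro!: continuous_intros)
  then have "continuous_on {0..1} f" unfolding f_def by (intro continuous_intros)
  then obtain z\<^sub>0 where z0: "z\<^sub>0 \<in> {0..1}" "\<And>z. z \<in> {0..1} \<Longrightarrow> f z\<^sub>0 \<le> f z"
    using continuous_attains_inf[of "{0..1::real}" f] by auto
  have "\<sigma> * \<xi> (half_branch False z\<^sub>0) < \<sigma> * \<xi> (half_branch True z\<^sub>0)"
    using z0(1) by (intro smono) (auto simp: half_branch_def)
  then have pos: "0 < f z\<^sub>0" by (simp add: f_def algebra_simps)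
  have "mean_zero_base \<xi> \<sigma> L k (f z\<^sub>0 / 2)"
  proof
    fix y z :: real assume "0 \<le> y" "y \<le> z" "z \<le> 1"
    then show "\<sigma> * \<xi> y \<le> \<sigma> * \<xi> z" using smono[of y z] by (cases "y = z") auto
  qed (use L k \<sigma> z0(2) pos mean in \<open>auto simp: f_def\<close>)
  then show thesis by (rule that)
qed

theorem theorem1p1:
  fixes \<xi> :: "real \<Rightarrow> real" and C :: real
  assumes "smooth_on {0..1} \<xi>"
    and "strict_mono_on {0..1} \<xi> \<or> strict_antimono_on {0..1} \<xi>"
    and "integral {0..1} \<xi> = 0"
    and "C > 0"
  shows "\<forall>\<^sub>F r\<^sub>0 in at_right 0. \<forall>G \<in> skew_maps \<xi> C r\<^sub>0. \<forall>x\<in>{0<..<1}. \<forall>p\<in>{0<..<1}. x < p \<longrightarrow>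
    (AE y in lebesgue_on {0..1}. passage_time G x p y < \<infinity>) \<and>
    (\<integral>\<^sup>+ y. ennreal_of_enat (passage_time G x p y) \<partial>lebesgue_on {0..1}) = \<infinity>"
proof -
  obtain \<sigma> L k \<delta> where base: "mean_zero_base \<xi> \<sigma> L k \<delta>"
    using mean_zero_base_exists[OF assms(1-3)] .
  interpret mean_zero_base \<xi> \<sigma> L k \<delta> by (rule base)
  have lim: "((\<lambda>r. 4 * exp k * r) \<longlongrightarrow> 0) (at_right 0)"
    by (rule tendsto_eq_intros refl | simp)+
  have explim: "((\<lambda>r. exp (4 * exp k * r)) \<longlongrightarrow> 1) (at_right 0)"
    using tendsto_exp[OF lim] by simp
  have "1 < cosh \<delta>" using delta_pos cosh_real_nonneg_less_iff[of 0 \<delta>] by simp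
  \<comment> \<open>Three strict inequalities that hold in the limit 0. They involve only
    \<open>k\<close> and \<open>\<delta>\<close>, which come from \<open>\<xi>\<close>, so the range
    of \<open>r\<^sub>0\<close> is uniform in \<open>G\<close>, \<open>x\<close> and
    \<open>p\<close>.\<close>
  then have ev: "\<forall>\<^sub>F r in at_right 0. exp (4 * exp k * r) < cosh \<delta>" "\<forall>\<^sub>F r in at_right 0. 4 * exp k * r < 1"
    "\<forall>\<^sub>F r in at_right 0. 4 * exp k * r < \<delta> / 4"
    using delta_pos by (intro order_tendstoD(2)[OF explim] order_tendstoD(2)[OF lim]; simp)+
  have "\<forall>\<^sub>F r in at_right (0::real). 0 < r" by (rule eventually_at_right_less)
  with ev show ?thesis
  proof eventually_elim
    case (elim r\<^sub>0)
    show ?case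
    proof (intro ballI impI)
      fix G :: "real \<times> real \<Rightarrow> real \<times> real" and x p :: real
      assume G: "G \<in> skew_maps \<xi> C r\<^sub>0" and x: "x \<in> {0<..<1}" "p \<in> {0<..<1}" "x < p"
      have r0: "exp k * r\<^sub>0 \<le> 1 / 2" using elim by linarith
      interpret logit_walk \<xi> \<sigma> L k \<delta> G r\<^sub>0 C
      proof
        fix y x :: real assume y: "y \<in> {0..<1}" and x: "x \<in> {0<..<1}"
        then have y': "y \<in> {0..1}" by simp
        show "fibre_map G y x \<in> {0<..<1}"
          "\<bar>logit (fibre_map G y x) - logit x - \<xi> y\<bar> \<le> 4 * exp k * min r\<^sub>0 (C * exp (logit x))"
          by (rule fibre_map_logit[OF G y' x bound[OF y'] \<open>C > 0\<close> r0])+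
      qed (use elim assms(4) in auto)
      show "(AE y in lebesgue_on {0..1}. passage_time G x p y < \<infinity>) \<and>
        (\<integral>\<^sup>+ y. ennreal_of_enat (passage_time G x p y) \<partial>lebesgue_on {0..1}) = \<infinity>"
        using passage_time_finite[OF x] passage_time_not_integrable[OF x] by blast
    qed
  qed
qed

end
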